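(* Let $(G,\eta\colon M\otimes G\to G)$ be an initial algebra of the endofunctor $M\otimes-$ on $\mathsf{SquaMS}$ (so $\eta$ is an isomorphism), let $Q=C(G)$ be the Cauchy completion, and let $\gamma\colon Q\to M\otimes Q$ be the composite of $C(\eta^{-1})\colon C(G)\to C(M\otimes G)$ with the canonical isometric isomorphism $C(M\otimes G)\cong M\otimes C(G)$ (sending the class of a Cauchy sequence $(m_k\otimes x_k)_k$ to $m^*\otimes(x_{k_j})_j$, where $m^*$ is an index occurring infinitely often and $(x_{k_j})$ the corresponding subsequence). Then $(Q,\gamma)$ is a final coalgebra for $M\otimes-\colon\mathsf{SquaMS}\to\mathsf{SquaMS}$.
   Context: Let $M_0=\{(r,s)\in[0,1]^2: r\in\{0,1\}\text{ or } s\in\{0,1\}\}$. A square metric space is a pair $(X,S_X)$ where $X$ is a metric space with all distances at most $2$ and $S_X\colon M_0\to X$ is injective, such that (sq1) for $i\in\{0,1\}$, $r,s\in[0,1]$: $d_X(S_X(i,r),S_X(i,s))=|s-r|$ and $d_X(S_X(r,i),S_X(s,i))=|s-r|$; (sq2) $d_X(S_X(r,s),S_X(t,u))\ge |r-t|+|s-u|$ for all $(r,s),(t,u)\in M_0$. $\mathsf{SquaMS}$ has these as objects and short maps $f$ with $f\circ S_X=S_Y$ as morphisms. Let $N=\{0,1,2\}^2$, $M=N\setminus\{(1,1)\}$, viewed also as points of $\mathbb{R}^2$. For $X$ in $\mathsf{SquaMS}$, $M\otimes X=(M\times X)/\!\sim$ where $\sim$ is the equivalence relation generated by $(m,S_X(p))\sim(n,S_X(q))$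 whenever $m,n$ differ by exactly $1$ in exactly one coordinate and $(m+p)/3=(n+q)/3$; $m\otimes x$ denotes the class of $(m,x)$. With $d((a,u),(b,v))=\frac13 d_X(u,v)$ if $a=b$ and $2$ otherwise on $M\times X$, the metric of $M\otimes X$ is the quotient metric (infimum over finite chains of the sum of consecutive distances, counting $\sim$-related consecutive pairs as $0$). $S_{M\otimes X}(p)=m\otimes S_X(3p-m)$ for any $m\in M$ with $p\in(m+[0,1]^2)/3$; $(M\otimes f)(m\otimes x)=m\otimes f(x)$. Cauchy completion $C(X)$ has $S_{C(X)}(p)$ the class of the constant sequence $S_X(p)$. An algebra for $F$ is $(A,a\colon FA\to A)$; a coalgebra is $(A,a\colon A\to FA)$; a coalgebra morphism $h\colon(A,a)\to(B,b)$ satisfies $b\circ h=Fh\circ a$; a final coalgebra admits a unique coalgebra morphism from every coalgebra. *)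

theory Defs
  imports "HOL-Analysis.Analysis"
begin

definition M0 :: "(real \<times> real) set" where
  "M0 = {(r,s). 0 \<le> r \<and> r \<le> 1 \<and> 0 \<le> s \<and> s \<le> 1 \<and> (r \<in> {0,1} \<or> s \<in> {0,1})}"

definition metric_on :: "'a set \<Rightarrow> ('a \<Rightarrow> 'a \<Rightarrow> real) \<Rightarrow> bool" where
  "metric_on X d \<longleftrightarrow>
     (\<forall>x\<in>X. \<forall>y\<in>X. 0 \<le> d x y \<and> d x y = d y x \<and> (d x y = 0 \<longleftrightarrow> x = y)) \<and>
     (\<forall>x\<in>X. \<forall>y\<in>X. \<forall>z\<in>X. d x z \<le> d x y + d y z)"

definition squams :: "'a set \<Rightarrow> ('a \<Rightarrow> 'a \<Rightarrow> real) \<Rightarrow> (real \<times> real \<Rightarrow> 'a) \<Rightarrow> bool" where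
  "squams X d S \<longleftrightarrow> metric_on X d \<and> (\<forall>x\<in>X. \<forall>y\<in>X. d x y \<le> 2) \<and>
     S ` M0 \<subseteq> X \<and> inj_on S M0 \<and>
     (\<forall>i\<in>{0::real,1}. \<forall>r\<in>{0..1}. \<forall>s\<in>{0..1}.
         d (S (i,r)) (S (i,s)) = \<bar>s - r\<bar> \<and> d (S (r,i)) (S (s,i)) = \<bar>s - r\<bar>) \<and>
     (\<forall>p\<in>M0. \<forall>q\<in>M0. d (S p) (S q) \<ge> \<bar>fst p - fst q\<bar> + \<bar>snd p - snd q\<bar>)"

definition sq_morph ::
  "'a set \<Rightarrow> ('a \<Rightarrow> 'a \<Rightarrow> real) \<Rightarrow> (real \<times> real \<Rightarrow> 'a) \<Rightarrow>
   'b set \<Rightarrow> ('b \<Rightarrow> 'b \<Rightarrow> real) \<Rightarrow> (real \<times> real \<Rightarrow> 'b) \<Rightarrow> ('a \<Rightarrow> 'b) \<Rightarrow> bool" where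
  "sq_morph X dX SX Y dY SY f \<longleftrightarrow> f ` X \<subseteq> Y \<and>
     (\<forall>x\<in>X. \<forall>y\<in>X. dY (f x) (f y) \<le> dX x y) \<and> (\<forall>p\<in>M0. f (SX p) = SY p)"

definition Mset :: "(nat \<times> nat) set" where
  "Mset = {(i,j). i < 3 \<and> j < 3} - {(1,1)}"

definition adjacent :: "nat \<times> nat \<Rightarrow> nat \<times> nat \<Rightarrow> bool" where
  "adjacent m n \<longleftrightarrow>
     (fst m = fst n \<and> (snd m = snd n + 1 \<or> snd n = snd m + 1)) \<or>
     (snd m = snd n \<and> (fst m = fst n + 1 \<or> fst n = fst m + 1))"

definition ten_base :: "(real \<times> real \<Rightarrow> 'a) \<Rightarrow> (((nat \<times> nat) \<times> 'a) \<times> ((nat \<times> nat) \<times> 'a)) set" where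
  "ten_base S = {((m, S p), (n, S q)) | m n p q. m \<in> Mset \<and> n \<in> Mset \<and> p \<in> M0 \<and> q \<in> M0 \<and>
      adjacent m n \<and>
      ((real (fst m) + fst p) / 3, (real (snd m) + snd p) / 3) =
      ((real (fst n) + fst q) / 3, (real (snd n) + snd q) / 3)}"

definition ten_rel :: "'a set \<Rightarrow> (real \<times> real \<Rightarrow> 'a) \<Rightarrow> (((nat \<times> nat) \<times> 'a) \<times> ((nat \<times> nat) \<times> 'a)) set" where
  "ten_rel X S = (ten_base S \<union> (ten_base S)\<inverse>)\<^sup>* \<inter> ((Mset \<times> X) \<times> (Mset \<times> X))"

definition ten_carrier :: "'a set \<Rightarrow> (real \<times> real \<Rightarrow> 'a) \<Rightarrow> ((nat \<times> nat) \<times> 'a) set set" where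
  "ten_carrier X S = (Mset \<times> X) // ten_rel X S"

definition ten_class :: "'a set \<Rightarrow> (real \<times> real \<Rightarrow> 'a) \<Rightarrow> (nat \<times> nat) \<times> 'a \<Rightarrow> ((nat \<times> nat) \<times> 'a) set" where
  "ten_class X S x = ten_rel X S `` {x}"

definition ten_d0 :: "('a \<Rightarrow> 'a \<Rightarrow> real) \<Rightarrow> (nat \<times> nat) \<times> 'a \<Rightarrow> (nat \<times> nat) \<times> 'a \<Rightarrow> real" where
  "ten_d0 d x y = (if fst x = fst y then d (snd x) (snd y) / 3 else 2)"

definition ten_dist :: "'a set \<Rightarrow> ('a \<Rightarrow> 'a \<Rightarrow> real) \<Rightarrow> (real \<times> real \<Rightarrow> 'a) \<Rightarrow>
    ((nat \<times> nat) \<times> 'a) set \<Rightarrow> ((nat \<times> nat) \<times> 'a) set \<Rightarrow> real" where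
  "ten_dist X d S c1 c2 = Inf {(\<Sum>i<length xs - 1.
        (if (xs ! i, xs ! Suc i) \<in> ten_rel X S then 0 else ten_d0 d (xs ! i) (xs ! Suc i)))
      | xs. xs \<noteq> [] \<and> set xs \<subseteq> Mset \<times> X \<and> hd xs \<in> c1 \<and> last xs \<in> c2}"

definition cell :: "nat \<times> nat \<Rightarrow> (real \<times> real) set" where
  "cell m = {((real (fst m) + a) / 3, (real (snd m) + b) / 3) | a b. a \<in> {0..1} \<and> b \<in> {0..1}}"

definition ten_S :: "'a set \<Rightarrow> (real \<times> real \<Rightarrow> 'a) \<Rightarrow> real \<times> real \<Rightarrow> ((nat \<times> nat) \<times> 'a) set" where
  "ten_S X S p = (let m = (SOME m. m \<in> Mset \<and> p \<in> cell m) in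
      ten_class X S (m, S (3 * fst p - real (fst m), 3 * snd p - real (snd m))))"

definition ten_map :: "'b set \<Rightarrow> (real \<times> real \<Rightarrow> 'b) \<Rightarrow> ('a \<Rightarrow> 'b) \<Rightarrow>
    ((nat \<times> nat) \<times> 'a) set \<Rightarrow> ((nat \<times> nat) \<times> 'b) set" where
  "ten_map Y SY f c = (let r = (SOME r. r \<in> c) in ten_class Y SY (fst r, f (snd r)))"

definition cauchy_seqs :: "'a set \<Rightarrow> ('a \<Rightarrow> 'a \<Rightarrow> real) \<Rightarrow> (nat \<Rightarrow> 'a) set" where
  "cauchy_seqs X d = {\<sigma>. range \<sigma> \<subseteq> X \<and>
      (\<forall>e>0. \<exists>N. \<forall>n n'. N \<le> n \<longrightarrow> N \<le> n' \<longrightarrow> d (\<sigma> n) (\<sigma> n') < e)}"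

definition cs_rel :: "'a set \<Rightarrow> ('a \<Rightarrow> 'a \<Rightarrow> real) \<Rightarrow> ((nat \<Rightarrow> 'a) \<times> (nat \<Rightarrow> 'a)) set" where
  "cs_rel X d = {(\<sigma>, \<tau>). \<sigma> \<in> cauchy_seqs X d \<and> \<tau> \<in> cauchy_seqs X d \<and>
      (\<lambda>n. d (\<sigma> n) (\<tau> n)) \<longlonglongrightarrow> 0}"

definition C_carrier :: "'a set \<Rightarrow> ('a \<Rightarrow> 'a \<Rightarrow> real) \<Rightarrow> (nat \<Rightarrow> 'a) set set" where
  "C_carrier X d = cauchy_seqs X d // cs_rel X d"

definition C_dist :: "('a \<Rightarrow> 'a \<Rightarrow> real) \<Rightarrow> (nat \<Rightarrow> 'a) set \<Rightarrow> (nat \<Rightarrow> 'a) set \<Rightarrow> real" where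
  "C_dist d c1 c2 = lim (\<lambda>n. d ((SOME \<sigma>. \<sigma> \<in> c1) n) ((SOME \<tau>. \<tau> \<in> c2) n))"

definition C_S :: "'a set \<Rightarrow> ('a \<Rightarrow> 'a \<Rightarrow> real) \<Rightarrow> (real \<times> real \<Rightarrow> 'a) \<Rightarrow> real \<times> real \<Rightarrow> (nat \<Rightarrow> 'a) set" where
  "C_S X d S p = cs_rel X d `` {\<lambda>_. S p}"

definition C_map :: "'b set \<Rightarrow> ('b \<Rightarrow> 'b \<Rightarrow> real) \<Rightarrow> ('a \<Rightarrow> 'b) \<Rightarrow> (nat \<Rightarrow> 'a) set \<Rightarrow> (nat \<Rightarrow> 'b) set" where
  "C_map Y dY f c = cs_rel Y dY `` {f \<circ> (SOME \<sigma>. \<sigma> \<in> c)}"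

definition canon :: "'a set \<Rightarrow> ('a \<Rightarrow> 'a \<Rightarrow> real) \<Rightarrow> (real \<times> real \<Rightarrow> 'a) \<Rightarrow>
    (nat \<Rightarrow> ((nat \<times> nat) \<times> 'a) set) set \<Rightarrow> ((nat \<times> nat) \<times> (nat \<Rightarrow> 'a) set) set" where
  "canon X d S c = (let \<sigma> = (SOME \<sigma>. \<sigma> \<in> c);
      r = (\<lambda>k. SOME r. r \<in> \<sigma> k);
      m = (SOME m. m \<in> Mset \<and> infinite {k. fst (r k) = m});
      ks = enumerate {k. fst (r k) = m}
    in ten_class (C_carrier X d) (C_S X d S) (m, cs_rel X d `` {\<lambda>j. snd (r (ks j))}))"

definition is_alg :: "'a set \<Rightarrow> ('a \<Rightarrow> 'a \<Rightarrow> real) \<Rightarrow> (real \<times> real \<Rightarrow> 'a) \<Rightarrow>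
    (((nat \<times> nat) \<times> 'a) set \<Rightarrow> 'a) \<Rightarrow> bool" where
  "is_alg A d S a \<longleftrightarrow> squams A d S \<and>
     sq_morph (ten_carrier A S) (ten_dist A d S) (ten_S A S) A d S a"

definition alg_morph :: "'a set \<Rightarrow> ('a \<Rightarrow> 'a \<Rightarrow> real) \<Rightarrow> (real \<times> real \<Rightarrow> 'a) \<Rightarrow>
    (((nat \<times> nat) \<times> 'a) set \<Rightarrow> 'a) \<Rightarrow>
    'b set \<Rightarrow> ('b \<Rightarrow> 'b \<Rightarrow> real) \<Rightarrow> (real \<times> real \<Rightarrow> 'b) \<Rightarrow>
    (((nat \<times> nat) \<times> 'b) set \<Rightarrow> 'b) \<Rightarrow> ('a \<Rightarrow> 'b) \<Rightarrow> bool" where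
  "alg_morph A dA SA a B dB SB b h \<longleftrightarrow> sq_morph A dA SA B dB SB h \<and>
     (\<forall>y\<in>ten_carrier A SA. h (a y) = b (ten_map B SB h y))"

definition is_coalg :: "'a set \<Rightarrow> ('a \<Rightarrow> 'a \<Rightarrow> real) \<Rightarrow> (real \<times> real \<Rightarrow> 'a) \<Rightarrow>
    ('a \<Rightarrow> ((nat \<times> nat) \<times> 'a) set) \<Rightarrow> bool" where
  "is_coalg A d S \<alpha> \<longleftrightarrow> squams A d S \<and>
     sq_morph A d S (ten_carrier A S) (ten_dist A d S) (ten_S A S) \<alpha>"

definition coalg_morph :: "'a set \<Rightarrow> ('a \<Rightarrow> 'a \<Rightarrow> real) \<Rightarrow> (real \<times> real \<Rightarrow> 'a) \<Rightarrow>
    ('a \<Rightarrow> ((nat \<times> nat) \<times> 'a) set) \<Rightarrow>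
    'b set \<Rightarrow> ('b \<Rightarrow> 'b \<Rightarrow> real) \<Rightarrow> (real \<times> real \<Rightarrow> 'b) \<Rightarrow>
    ('b \<Rightarrow> ((nat \<times> nat) \<times> 'b) set) \<Rightarrow> ('a \<Rightarrow> 'b) \<Rightarrow> bool" where
  "coalg_morph A dA SA \<alpha> B dB SB \<beta> h \<longleftrightarrow> sq_morph A dA SA B dB SB h \<and>
     (\<forall>x\<in>A. \<beta> (h x) = ten_map B SB h (\<alpha> x))"

definition gammaQ :: "'a set \<Rightarrow> ('a \<Rightarrow> 'a \<Rightarrow> real) \<Rightarrow> (real \<times> real \<Rightarrow> 'a) \<Rightarrow>
    (((nat \<times> nat) \<times> 'a) set \<Rightarrow> 'a) \<Rightarrow> (nat \<Rightarrow> 'a) set \<Rightarrow> ((nat \<times> nat) \<times> (nat \<Rightarrow> 'a) set) set" where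
  "gammaQ G d S \<eta> q = canon G d S
     (C_map (ten_carrier G S) (ten_dist G d S) (inv_into (ten_carrier G S) \<eta>) q)"

end

theory Submission
  imports Defs
begin

text \<open>
  Writing \<open>\<Theta> m q = \<gamma>\<^sup>-\<^sup>1(m \<otimes> q)\<close>, each \<open>\<Theta> m\<close> contracts \<open>Q\<close> by the factor 1/3. A coalgebra morphism
  \<open>h\<close> from \<open>(A, \<alpha>)\<close> is therefore a fixed point of a contraction on maps \<open>A \<rightarrow> Q\<close>, which gives
  uniqueness and, \<open>Q\<close> being complete, a unique map \<open>h\<close> with \<open>\<gamma> \<circ> h = (M \<otimes> h) \<circ> \<alpha>\<close>; this \<open>h\<close> preserves
  the boundary. The real issue is that \<open>h\<close> is short.

  Suppose first that it is short on the boundary. If \<open>h\<close> increases distances by at most \<open>e\<close>, then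
  along a chain in \<open>M \<otimes> A\<close> only the first and the last segment have an endpoint off the cell
  boundaries, so \<open>h\<close> increases distances by at most \<open>2e/3\<close>, and iteration gives \<open>e = 0\<close>.

  On the boundary, distances in \<open>A\<close> only dominate the taxicab metric, whereas those in \<open>Q\<close> are
  the larger path distances around the holes. Given a 1-Lipschitz function on \<open>Q\<close>, replace its
  restriction to each edge by the smallest 1-Lipschitz function with the same values at the two
  ends. The result is 1-Lipschitz for the taxicab metric, hence for that of \<open>A\<close>. Doing this in
  every cell and pulling back along \<open>\<alpha>\<close> shows the same when the values are kept at all multiples
  of \<open>1/3\<close>, then at those of \<open>1/9\<close>, and so on; in the limit the function itself is 1-Lipschitz on the
  boundary of \<open>A\<close>.
\<close>

section \<open>The quotient metric\<close>

definition taxi :: "real \<times> real \<Rightarrow> real \<times> real \<Rightarrow> real" where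
  "taxi p q = \<bar>fst p - fst q\<bar> + \<bar>snd p - snd q\<bar>"

text \<open>Position of a cell point in the plane, magnified by 3: the gluing condition becomes an
  equality of shifts, and taxicab distances inside a cell are unchanged.\<close>

definition shift :: "nat \<times> nat \<Rightarrow> real \<times> real \<Rightarrow> real \<times> real" where
  "shift m p = (real (fst m) + fst p, real (snd m) + snd p)"

lemma taxi_nonneg [simp]: "0 \<le> taxi p q"
  by (simp add: taxi_def)

lemma taxi_self [simp]: "taxi p p = 0"
  by (simp add: taxi_def)

lemma taxi_commute: "taxi p q = taxi q p"
  by (simp add: taxi_def abs_minus_commute)

lemma taxi_triangle: "taxi p r \<le> taxi p q + taxi q r"
  unfolding taxi_def by linarith

lemma taxi_eq_0_iff: "taxi p q = 0 \<longleftrightarrow> p = q"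
  unfolding taxi_def prod_eq_iff by linarith

lemma taxi_shift [simp]: "taxi (shift m p) (shift m q) = taxi p q"
  by (simp add: taxi_def shift_def)

lemma M0_cases:
  assumes "p \<in> M0"
  obtains (vertical) i r where "p = (i, r)" "i \<in> {0, 1}" "r \<in> {0..1}"
  | (horizontal) i r where "p = (r, i)" "i \<in> {0, 1}" "r \<in> {0..1}"
  using assms by (cases p) (auto simp: M0_def)

lemma M0_verticalI: "i \<in> {0, 1} \<Longrightarrow> r \<in> {0..1} \<Longrightarrow> (i, r) \<in> M0"
  by (auto simp: M0_def)

lemma M0_horizontalI: "i \<in> {0, 1} \<Longrightarrow> r \<in> {0..1} \<Longrightarrow> (r, i) \<in> M0"
  by (auto simp: M0_def)

lemma M0_bounds: "p \<in> M0 \<Longrightarrow> 0 \<le> fst p \<and> fst p \<le> 1 \<and> 0 \<le> snd p \<and> snd p \<le> 1"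
  by (auto simp: M0_def)

lemma M0_corner [simp]: "(0, 0) \<in> M0"
  by (simp add: M0_def)

lemma compact_M0: "compact M0"
proof -
  have "M0 = ({0,1} \<times> {0..1}) \<union> ({0..1} \<times> {0,1})"
    by (auto simp: M0_def)
  moreover have "compact (({0,1} \<times> {0..1}) \<union> ({0..1} \<times> {0,1::real}) :: (real \<times> real) set)"
    by (intro compact_Un compact_Times compact_Icc) auto
  ultimately show ?thesis by simp
qed

lemma finite_Mset: "finite Mset"
  by (rule finite_subset[of _ "{..<3} \<times> {..<3}"]) (auto simp: Mset_def)

lemma unit_interval_thirds:
  fixes s :: real
  assumes "s \<in> {0..1}"
  obtains i t where "i < (3::nat)" "t \<in> {0..1}" "s = (real i + t) / 3"
proof -
  consider "3 * s \<le> 1" | "1 \<le> 3 * s" "3 * s \<le> 2" | "2 \<le> 3 * s" by linarith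
  thus ?thesis
  proof cases
    case 1 thus ?thesis using assms that[of 0 "3 * s"] by auto
  next
    case 2 thus ?thesis using assms that[of 1 "3 * s - 1"] by auto
  next
    case 3 thus ?thesis using assms that[of 2 "3 * s - 2"] by auto
  qed
qed

text \<open>The coordinate of \<open>p\<close> that is 0 or 1 forces an outer row or column, so the
  cell is never the missing centre; the other coordinate is split into thirds.\<close>

lemma M0_cell:
  assumes "p \<in> M0"
  obtains m q where "m \<in> Mset" "q \<in> M0" "shift m q = (3 * fst p, 3 * snd p)"
  using assms
proof (cases rule: M0_cases)
  case (vertical i r)
  obtain j t where "j < (3::nat)" "t \<in> {0..1}" "r = (real j + t) / 3"
    using vertical(3) by (rule unit_interval_thirds)
  thus ?thesis
    by (intro that[of "(if i = 0 then 0 else 2, j)" "(i, t)"])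
      (use vertical in \<open>auto simp: Mset_def M0_def shift_def\<close>)
next
  case (horizontal i r)
  obtain j t where "j < (3::nat)" "t \<in> {0..1}" "r = (real j + t) / 3"
    using horizontal(3) by (rule unit_interval_thirds)
  thus ?thesis
    by (intro that[of "(j, if i = 0 then 0 else 2)" "(t, i)"])
      (use horizontal in \<open>auto simp: Mset_def M0_def shift_def\<close>)
qed

text \<open>Holds for every cell containing \<open>p\<close>, because the cell in
  \<open>ten_S\<close> comes from a choice operator. A coordinate 0 or 1 of \<open>p\<close> can
  only arise from local coordinate 0 or 1.\<close>

lemma M0_cell_local:
  assumes "p \<in> M0" "m \<in> Mset" "p \<in> cell m"
  shows "(3 * fst p - real (fst m), 3 * snd p - real (snd m)) \<in> M0"
proof -
  obtain a b where ab: "p = ((real (fst m) + a) / 3, (real (snd m) + b) / 3)" "a \<in> {0..1}" "b \<in> {0..1}"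
    using assms(3) by (auto simp: cell_def)
  have m: "fst m < 3" "snd m < 3" using assms(2) by (auto simp: Mset_def)
  have *: "a = 0 \<or> a = 1" if "(real n + a) / 3 \<in> {0, 1}" "n < 3" "a \<in> {0..1}" for a n
    using that by (auto simp: field_simps)
  have "a \<in> {0,1} \<or> b \<in> {0,1}"
    using assms(1) *[of "fst m" a] *[of "snd m" b] m ab by (auto simp: M0_def)
  moreover have "3 * fst p - real (fst m) = a" "3 * snd p - real (snd m) = b"
    using ab by (auto simp: field_simps)
  ultimately show ?thesis using ab by (auto simp: M0_def)
qed

lemma cellI: "q \<in> M0 \<Longrightarrow> shift m q = (3 * fst p, 3 * snd p) \<Longrightarrow> p \<in> cell m"
  unfolding cell_def shift_def using M0_bounds[of q]
  by (intro CollectI exI[of _ "fst q"] exI[of _ "snd q"]) (auto simp: prod_eq_iff)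

section \<open>Functions that descend to the quotient\<close>

definition compatible :: "(real \<times> real \<Rightarrow> 'a) \<Rightarrow> ((nat \<times> nat) \<times> 'a \<Rightarrow> 'b) \<Rightarrow> bool" where
  "compatible S g \<longleftrightarrow> (\<forall>m\<in>Mset. \<forall>n\<in>Mset. \<forall>p\<in>M0. \<forall>q\<in>M0.
     adjacent m n \<longrightarrow> shift m p = shift n q \<longrightarrow> g (m, S p) = g (n, S q))"

lemma compatibleD:
  "compatible S g \<Longrightarrow> m \<in> Mset \<Longrightarrow> n \<in> Mset \<Longrightarrow> p \<in> M0 \<Longrightarrow> q \<in> M0 \<Longrightarrow>
   adjacent m n \<Longrightarrow> shift m p = shift n q \<Longrightarrow> g (m, S p) = g (n, S q)"
  by (auto simp: compatible_def)

lemma ten_base_iff: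
  "(x, y) \<in> ten_base S \<longleftrightarrow> (\<exists>m n p q. x = (m, S p) \<and> y = (n, S q) \<and> m \<in> Mset \<and> n \<in> Mset \<and>
     p \<in> M0 \<and> q \<in> M0 \<and> adjacent m n \<and> shift m p = shift n q)"
proof -
  have "((real (fst m) + fst p) / 3, (real (snd m) + snd p) / 3) =
      ((real (fst n) + fst q) / 3, (real (snd n) + snd q) / 3) \<longleftrightarrow> shift m p = shift n q"
    for m n p q unfolding shift_def by (simp add: field_simps) linarith
  thus ?thesis unfolding ten_base_def by auto
qed

lemma sym_ten_rel: "sym (ten_rel X S)"
proof -
  have "sym ((ten_base S \<union> (ten_base S)\<inverse>)\<^sup>*)"
    by (intro sym_rtrancl sym_Un_converse)
  thus ?thesis unfolding ten_rel_def by (auto simp: sym_def)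
qed

lemma equiv_ten_rel: "equiv (Mset \<times> X) (ten_rel X S)"
proof (rule equivI)
  show "ten_rel X S \<subseteq> (Mset \<times> X) \<times> (Mset \<times> X)"
    by (auto simp: ten_rel_def)
  show "refl_on (Mset \<times> X) (ten_rel X S)"
    by (auto simp: ten_rel_def refl_on_def)
  show "sym (ten_rel X S)" by (rule sym_ten_rel)
  show "trans (ten_rel X S)"
    unfolding ten_rel_def trans_def by (auto intro: rtrancl_trans)
qed

lemma ten_class_eq_iff:
  "x \<in> Mset \<times> X \<Longrightarrow> y \<in> Mset \<times> X \<Longrightarrow>
   ten_class X S x = ten_class X S y \<longleftrightarrow> (x, y) \<in> ten_rel X S"
  unfolding ten_class_def by (rule eq_equiv_class_iff[OF equiv_ten_rel])

lemma ten_class_self: "x \<in> Mset \<times> X \<Longrightarrow> x \<in> ten_class X S x"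
  by (simp add: ten_class_def ten_rel_def)

lemma ten_class_self_pair [simp]: "m \<in> Mset \<Longrightarrow> x \<in> X \<Longrightarrow> (m, x) \<in> ten_class X S (m, x)"
  by (simp add: ten_class_self)

lemma ten_class_in: "x \<in> Mset \<times> X \<Longrightarrow> ten_class X S x \<in> ten_carrier X S"
  by (simp add: ten_class_def ten_carrier_def quotientI)

lemma in_ten_class: "y \<in> ten_class X S x \<Longrightarrow> (x, y) \<in> ten_rel X S \<and> x \<in> Mset \<times> X \<and> y \<in> Mset \<times> X"
  by (auto simp: ten_class_def ten_rel_def)

lemma ten_carrier_someI:
  assumes "c \<in> ten_carrier X S"
  shows "(SOME r. r \<in> c) \<in> Mset \<times> X" "ten_class X S (SOME r. r \<in> c) = c"
proof -
  obtain x where x: "x \<in> Mset \<times> X" "c = ten_class X S x"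
    using assms by (auto simp: ten_carrier_def ten_class_def quotient_def)
  have "(SOME r. r \<in> c) \<in> c" using ten_class_self[OF x(1)] x(2) by (intro someI[of "\<lambda>r. r \<in> c"]) auto
  from in_ten_class[OF this[unfolded x(2)]] x
  show "(SOME r. r \<in> c) \<in> Mset \<times> X" "ten_class X S (SOME r. r \<in> c) = c"
    using ten_class_eq_iff[OF x(1), of "SOME r. r \<in> c" S] by simp_all
qed

lemma ten_rel_compatible:
  assumes "(x, y) \<in> ten_rel X S" "compatible S g"
  shows "g x = g y"
proof -
  have "(x, y) \<in> (ten_base S \<union> (ten_base S)\<inverse>)\<^sup>*" using assms(1) by (simp add: ten_rel_def)
  thus ?thesis
    by (induction rule: rtrancl_induct) (use assms(2) in \<open>auto simp: ten_base_iff dest: compatibleD\<close>)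
qed

text \<open>A class that meets a cell boundary consists of boundary points at one position in the
  plane. Injectivity of \<open>S\<close> makes the parameter of each intermediate point unique, so
  consecutive generating pairs fit together.\<close>

lemma ten_rel_boundary:
  assumes "((m, S p), y) \<in> ten_rel X S" "inj_on S M0" "p \<in> M0"
  obtains n q where "y = (n, S q)" "q \<in> M0" "shift n q = shift m p"
proof -
  have "((m, S p), y) \<in> (ten_base S \<union> (ten_base S)\<inverse>)\<^sup>*" using assms(1) by (simp add: ten_rel_def)
  hence "\<exists>n q. y = (n, S q) \<and> q \<in> M0 \<and> shift n q = shift m p"
  proof (induction rule: rtrancl_induct)
    case base thus ?case using assms(3) by blast
  next
    case (step y z)
    thus ?case using inj_onD[OF assms(2)] by (auto simp: ten_base_iff) metis+
  qed
  thus ?thesis using that by blast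
qed

section \<open>Distances and gluing in a square metric space\<close>

locale metric_set =
  fixes X :: "'a set" and d :: "'a \<Rightarrow> 'a \<Rightarrow> real"
  assumes metric: "metric_on X d"
begin

lemma d_nonneg: "x \<in> X \<Longrightarrow> y \<in> X \<Longrightarrow> 0 \<le> d x y" using metric by (simp add: metric_on_def)
lemma d_commute: "x \<in> X \<Longrightarrow> y \<in> X \<Longrightarrow> d x y = d y x" using metric by (simp add: metric_on_def)
lemma d_eq_0_iff: "x \<in> X \<Longrightarrow> y \<in> X \<Longrightarrow> d x y = 0 \<longleftrightarrow> x = y" using metric by (simp add: metric_on_def)
lemma d_self [simp]: "x \<in> X \<Longrightarrow> d x x = 0" by (simp add: d_eq_0_iff)
lemma d_triangle: "x \<in> X \<Longrightarrow> y \<in> X \<Longrightarrow> z \<in> X \<Longrightarrow> d x z \<le> d x y + d y z"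
  using metric by (simp add: metric_on_def)

end

locale squams_space =
  fixes X :: "'a set" and d :: "'a \<Rightarrow> 'a \<Rightarrow> real" and S :: "real \<times> real \<Rightarrow> 'a"
  assumes squams: "squams X d S"

sublocale squams_space \<subseteq> metric_set X d
  by unfold_locales (use squams in \<open>simp add: squams_def\<close>)

context squams_space
begin

abbreviation cls where "cls \<equiv> ten_class X S"
abbreviation td where "td \<equiv> ten_dist X d S"

lemma d_le_2: "x \<in> X \<Longrightarrow> y \<in> X \<Longrightarrow> d x y \<le> 2" using squams by (simp add: squams_def)
lemma S_in [simp]: "p \<in> M0 \<Longrightarrow> S p \<in> X" using squams by (auto simp: squams_def)
lemma S_inj: "inj_on S M0" using squams by (simp add: squams_def)
lemma S_vertical: "i \<in> {0,1} \<Longrightarrow> r \<in> {0..1} \<Longrightarrow> s \<in> {0..1} \<Longrightarrow> d (S (i,r)) (S (i,s)) = \<bar>s - r\<bar>"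
  using squams unfolding squams_def by blast
lemma S_horizontal: "i \<in> {0,1} \<Longrightarrow> r \<in> {0..1} \<Longrightarrow> s \<in> {0..1} \<Longrightarrow> d (S (r,i)) (S (s,i)) = \<bar>s - r\<bar>"
  using squams unfolding squams_def by blast
lemma taxi_le_d: "p \<in> M0 \<Longrightarrow> q \<in> M0 \<Longrightarrow> taxi p q \<le> d (S p) (S q)"
  using squams unfolding squams_def taxi_def by blast

text \<open>Some corner lies on the edge of \<open>p\<close> and shares an edge with
  \<open>w\<close>; the path through it is monotone in both coordinates, so its length is the
  taxicab distance.\<close>

lemma S_dist_corner:
  assumes "p \<in> M0" "w \<in> {0,1} \<times> {0,1}"
  shows "d (S p) (S w) \<le> taxi p w"
  using assms(1)
proof (cases rule: M0_cases)
  case (vertical i r)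
  obtain j k where w: "w = (j, k)" "j \<in> {0,1}" "k \<in> {0,1}" using assms(2) by auto
  have "d (S (i,r)) (S (j,k)) \<le> d (S (i,r)) (S (i,k)) + d (S (i,k)) (S (j,k))"
    by (intro d_triangle S_in M0_verticalI) (use vertical w in auto)
  also have "\<dots> = \<bar>k - r\<bar> + \<bar>j - i\<bar>"
    by (intro arg_cong2[of _ _ _ _ "(+)"] S_vertical S_horizontal) (use vertical w in auto)
  finally show ?thesis using vertical w by (simp add: taxi_def abs_minus_commute)
next
  case (horizontal i r)
  obtain j k where w: "w = (j, k)" "j \<in> {0,1}" "k \<in> {0,1}" using assms(2) by auto
  have "d (S (r,i)) (S (j,k)) \<le> d (S (r,i)) (S (j,i)) + d (S (j,i)) (S (j,k))"
    by (intro d_triangle S_in M0_horizontalI) (use horizontal w in auto)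
  also have "\<dots> = \<bar>j - r\<bar> + \<bar>k - i\<bar>"
    by (intro arg_cong2[of _ _ _ _ "(+)"] S_vertical S_horizontal) (use horizontal w in auto)
  finally show ?thesis using horizontal w by (simp add: taxi_def abs_minus_commute)
qed

text \<open>Only points on opposite edges can be further apart than in the taxicab metric.\<close>

lemma S_dist_near:
  assumes pq: "p \<in> M0" "q \<in> M0" and near: "taxi p q < 1"
  shows "d (S p) (S q) \<le> taxi p q"
proof -
  have adj: "d (S (i,r)) (S (s,j)) \<le> taxi (i,r) (s,j)"
    if "i \<in> {0,1}" "j \<in> {0,1}" "r \<in> {0..1}" "s \<in> {0..1}" for i j r s
  proof -
    have "d (S (i,r)) (S (s,j)) \<le> d (S (i,r)) (S (i,j)) + d (S (i,j)) (S (s,j))"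
      by (intro d_triangle S_in) (use that in \<open>auto simp: M0_def\<close>)
    also have "\<dots> = \<bar>j - r\<bar> + \<bar>s - i\<bar>"
      by (intro arg_cong2[of _ _ _ _ "(+)"] S_vertical S_horizontal) (use that in auto)
    finally show ?thesis by (simp add: taxi_def abs_minus_commute)
  qed
  from pq(1) show ?thesis
  proof (cases rule: M0_cases)
    case p: (vertical i r)
    from pq(2) show ?thesis
    proof (cases rule: M0_cases)
      case q: (vertical j s)
      have "i = j" using near p q by (auto simp: taxi_def)
      thus ?thesis using p q S_vertical[of i r s] by (simp add: taxi_def abs_minus_commute)
    next
      case (horizontal j s)
      thus ?thesis using adj p by simp
    qed
  next
    case p: (horizontal i r)
    from pq(2) show ?thesis
    proof (cases rule: M0_cases)
      case q: (vertical j s)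
      thus ?thesis using adj[of j i s r] p d_commute[of "S p" "S q"] pq taxi_commute[of p q] by simp
    next
      case q: (horizontal j s)
      have "i = j" using near p q by (auto simp: taxi_def)
      thus ?thesis using p q S_horizontal[of i r s] by (simp add: taxi_def abs_minus_commute)
    qed
  qed
qed

text \<open>For points at taxicab distance at least 1 the diameter bound 2 suffices. This crude
  estimate gives continuity along the boundary.\<close>

lemma S_dist_le_2_taxi:
  assumes "p \<in> M0" "q \<in> M0"
  shows "d (S p) (S q) \<le> 2 * taxi p q"
proof (cases "taxi p q < 1")
  case True
  thus ?thesis using S_dist_near[OF assms] taxi_nonneg[of p q] by linarith
next
  case False
  thus ?thesis using d_le_2[of "S p" "S q"] assms by simp
qed

text \<open>The generating relation only mentions cells that share an edge. Two cells that touch in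
  a corner are joined through one of the two cells adjacent to both; at most one of these is the
  missing centre.\<close>

lemma ten_glue:
  assumes mn: "m \<in> Mset" "n \<in> Mset" and pq: "p \<in> M0" "q \<in> M0" and eq: "shift m p = shift n q"
  shows "cls (m, S p) = cls (n, S q)"
proof -
  have step: "cls (m, S p) = cls (n, S q)"
    if "m \<in> Mset" "n \<in> Mset" "p \<in> M0" "q \<in> M0" "shift m p = shift n q" "adjacent m n" for m n p q
  proof -
    have "((m, S p), (n, S q)) \<in> ten_base S" using that unfolding ten_base_iff by blast
    hence "((m, S p), (n, S q)) \<in> ten_rel X S"
      using that unfolding ten_rel_def by (intro IntI r_into_rtrancl) auto
    thus ?thesis using that by (subst ten_class_eq_iff) auto
  qed
  obtain m1 m2 n1 n2 where m: "m = (m1,m2)" and n: "n = (n1,n2)" by (cases m, cases n)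
  obtain p1 p2 q1 q2 where p: "p = (p1,p2)" and q: "q = (q1,q2)" by (cases p, cases q)
  have b: "0 \<le> p1" "p1 \<le> 1" "0 \<le> p2" "p2 \<le> 1" "0 \<le> q1" "q1 \<le> 1" "0 \<le> q2" "q2 \<le> 1"
    using M0_bounds[OF pq(1)] M0_bounds[OF pq(2)] p q by auto
  have e: "real m1 + p1 = real n1 + q1" "real m2 + p2 = real n2 + q2"
    using eq by (auto simp: shift_def m n p q)
  have l: "m1 \<le> n1 + 1" "n1 \<le> m1 + 1" "m2 \<le> n2 + 1" "n2 \<le> m2 + 1"
    using b e by linarith+
  consider "m1 = n1" "m2 = n2" | "adjacent m n" | "m1 \<noteq> n1" "m2 \<noteq> n2"
    using l unfolding adjacent_def m n by force
  thus ?thesis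
  proof cases
    case 1 thus ?thesis using e m n p q by auto
  next
    case 2 thus ?thesis using step mn pq eq by blast
  next
    case 3
    \<comment> \<open>Both indices differ by exactly 1, so the common point is a corner of both
      cells.\<close>
    have c: "p1 \<in> {0,1}" "p2 \<in> {0,1}" "q1 \<in> {0,1}" "q2 \<in> {0,1}"
      using 3 l e b by auto
    show ?thesis
    proof (cases "(m1, n2) \<in> Mset")
      case True
      have "cls (m, S p) = cls ((m1,n2), S (p1,q2))"
        by (rule step) (use mn pq True c e l 3 in \<open>auto simp: m n p q shift_def adjacent_def M0_def\<close>)
      also have "\<dots> = cls (n, S q)"
        by (rule step) (use mn pq True c e l 3 in \<open>auto simp: m n p q shift_def adjacent_def M0_def\<close>)
      finally show ?thesis .
    next
      case False
      hence T: "(n1, m2) \<in> Mset" using mn 3 by (auto simp: Mset_def m n)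
      have "cls (m, S p) = cls ((n1,m2), S (q1,p2))"
        by (rule step) (use mn pq T c e l 3 in \<open>auto simp: m n p q shift_def adjacent_def M0_def\<close>)
      also have "\<dots> = cls (n, S q)"
        by (rule step) (use mn pq T c e l 3 in \<open>auto simp: m n p q shift_def adjacent_def M0_def\<close>)
      finally show ?thesis .
    qed
  qed
qed

lemma compatible_cls: "compatible S (\<lambda>x. f (cls x))"
  unfolding compatible_def by (auto intro: arg_cong[OF ten_glue])

text \<open>Frees \<open>ten_S\<close> from its chosen cell: any cell with the right position
  represents the point, by \<open>ten_glue\<close>.\<close>

lemma ten_S_eq:
  assumes "p \<in> M0" "m \<in> Mset" "q \<in> M0" "shift m q = (3 * fst p, 3 * snd p)"
  shows "ten_S X S p = cls (m, S q)"
proof -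
  define k where "k = (SOME m. m \<in> Mset \<and> p \<in> cell m)"
  have k: "k \<in> Mset \<and> p \<in> cell k"
    unfolding k_def by (rule someI[of _ m]) (use assms cellI in auto)
  have "ten_S X S p = cls (k, S (3 * fst p - real (fst k), 3 * snd p - real (snd k)))"
    by (simp add: ten_S_def k_def Let_def)
  also have "\<dots> = cls (m, S q)"
    by (rule ten_glue) (use k assms M0_cell_local in \<open>auto simp: shift_def\<close>)
  finally show ?thesis .
qed

section \<open>Chains and the pseudometric they define\<close>

definition chain_cost :: "((nat \<times> nat) \<times> 'a) list \<Rightarrow> real" where
  "chain_cost xs = (\<Sum>i<length xs - 1.
     if (xs ! i, xs ! Suc i) \<in> ten_rel X S then 0 else ten_d0 d (xs ! i) (xs ! Suc i))"

lemma chain_cost_single: "chain_cost [x] = 0"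
  by (simp add: chain_cost_def)

lemma chain_cost_snoc:
  assumes "xs \<noteq> []"
  shows "chain_cost (xs @ [y]) =
    chain_cost xs + (if (last xs, y) \<in> ten_rel X S then 0 else ten_d0 d (last xs) y)"
proof -
  obtain n where n: "length xs = Suc n" using assms by (cases xs) auto
  have "(\<Sum>i<n. if ((xs @ [y]) ! i, (xs @ [y]) ! Suc i) \<in> ten_rel X S then 0
        else ten_d0 d ((xs @ [y]) ! i) ((xs @ [y]) ! Suc i))
      = (\<Sum>i<n. if (xs ! i, xs ! Suc i) \<in> ten_rel X S then 0 else ten_d0 d (xs ! i) (xs ! Suc i))"
    using n by (intro sum.cong) (auto simp: nth_append)
  thus ?thesis using n assms by (simp add: chain_cost_def nth_append last_conv_nth)
qed

lemma ten_dist_alt: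
  "td c c' = Inf (chain_cost ` {xs. xs \<noteq> [] \<and> set xs \<subseteq> Mset \<times> X \<and> hd xs \<in> c \<and> last xs \<in> c'})"
  unfolding ten_dist_def chain_cost_def image_def by (rule arg_cong[of _ _ Inf]) auto

text \<open>The increments of the potential \<open>g\<close> telescope: a free step leaves
  \<open>g\<close> constant, a step in a cell is covered by \<open>lip\<close>, and a jump between
  cells by \<open>cap\<close>.\<close>

lemma chain_cost_bound:
  assumes comp: "compatible S g"
    and lip: "\<And>m x y. m \<in> Mset \<Longrightarrow> x \<in> X \<Longrightarrow> y \<in> X \<Longrightarrow> g (m, y) - g (m, x) \<le> d x y / 3"
    and cap: "\<And>x y. x \<in> Mset \<times> X \<Longrightarrow> y \<in> Mset \<times> X \<Longrightarrow> g y - g x \<le> 2"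
    and xs: "xs \<noteq> []" "set xs \<subseteq> Mset \<times> X"
  shows "g (last xs) - g (hd xs) \<le> chain_cost xs"
  using xs
proof (induction xs rule: rev_induct)
  case (snoc y xs)
  show ?case
  proof (cases "xs = []")
    case True thus ?thesis by (simp add: chain_cost_single)
  next
    case False
    have l: "last xs \<in> Mset \<times> X" "y \<in> Mset \<times> X" using snoc.prems False by auto
    have "g y - g (last xs) \<le> (if (last xs, y) \<in> ten_rel X S then 0 else ten_d0 d (last xs) y)"
      using ten_rel_compatible[OF _ comp, of "last xs" y X] l cap[OF l]
        lip[of "fst y" "snd (last xs)" "snd y"]
      unfolding ten_d0_def by (cases "last xs", cases y) auto
    thus ?thesis using snoc False by (simp add: chain_cost_snoc)
  qed
qed simp

lemma chain_cost_nonneg: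
  "xs \<noteq> [] \<Longrightarrow> set xs \<subseteq> Mset \<times> X \<Longrightarrow> 0 \<le> chain_cost xs"
  using chain_cost_bound[of "\<lambda>_. 0" xs] by (simp add: compatible_def d_nonneg)

lemma td_nonneg: "x \<in> Mset \<times> X \<Longrightarrow> y \<in> Mset \<times> X \<Longrightarrow> 0 \<le> td (cls x) (cls y)"
  unfolding ten_dist_alt
  by (rule cInf_greatest) (use chain_cost_nonneg in \<open>auto intro!: exI[of _ "[x,y]"]\<close>)

lemma td_le_chain:
  assumes "xs \<noteq> []" "set xs \<subseteq> Mset \<times> X" "hd xs \<in> c" "last xs \<in> c'"
  shows "td c c' \<le> chain_cost xs"
  unfolding ten_dist_alt
  by (rule cInf_lower) (use assms chain_cost_nonneg in \<open>auto intro!: bdd_belowI[of _ 0]\<close>)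

text \<open>The quotient metric is the largest one below the cell metrics, so every compatible function
  that is Lipschitz on the cells bounds it from below. All lower estimates of distances in
  \<open>M \<otimes> X\<close> are obtained this way, without looking at chains. The cap at 2 is the
  cost of a jump between different cells.\<close>

lemma td_lower:
  assumes comp: "compatible S g"
    and lip: "\<And>m x y. m \<in> Mset \<Longrightarrow> x \<in> X \<Longrightarrow> y \<in> X \<Longrightarrow> g (m, y) - g (m, x) \<le> d x y / 3"
    and u: "u \<in> Mset \<times> X" and v: "v \<in> Mset \<times> X"
  shows "min 2 (g v - g u) \<le> td (cls u) (cls v)"
  unfolding ten_dist_alt
proof (rule cInf_greatest)
  show "chain_cost ` {xs. xs \<noteq> [] \<and> set xs \<subseteq> Mset \<times> X \<and> hd xs \<in> cls u \<and> last xs \<in> cls v} \<noteq> {}"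
    using u v by (auto intro!: exI[of _ "[u,v]"])
  fix t assume "t \<in> chain_cost ` {xs. xs \<noteq> [] \<and> set xs \<subseteq> Mset \<times> X \<and> hd xs \<in> cls u \<and> last xs \<in> cls v}"
  then obtain xs where xs: "t = chain_cost xs" "xs \<noteq> []" "set xs \<subseteq> Mset \<times> X"
    "hd xs \<in> cls u" "last xs \<in> cls v" by auto
  \<comment> \<open>Truncating to the interval from 0 to 2 enforces the cap and keeps compatibility
    and the Lipschitz bound.\<close>
  define f where "f x = max 0 (min 2 (g x - g u))" for x
  have f: "compatible S f" using comp by (auto simp: compatible_def f_def)
  have "f (last xs) - f (hd xs) \<le> t"
    unfolding xs(1)
  proof (rule chain_cost_bound[OF f _ _ xs(2,3)])
    fix m x y assume "m \<in> Mset" "x \<in> X" "y \<in> X"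
    thus "f (m, y) - f (m, x) \<le> d x y / 3"
      using lip[of m x y] d_nonneg[of x y] by (auto simp: f_def max_def min_def)
  next
    fix x y show "f y - f x \<le> 2" by (auto simp: f_def)
  qed
  moreover have "f (hd xs) = f u" "f (last xs) = f v"
    using ten_rel_compatible[OF _ f, of u "hd xs" X] ten_rel_compatible[OF _ f, of v "last xs" X]
      in_ten_class[OF xs(4)] in_ten_class[OF xs(5)] by auto
  ultimately show "min 2 (g v - g u) \<le> t" by (auto simp: f_def)
qed

lemma td_self: "x \<in> Mset \<times> X \<Longrightarrow> td (cls x) (cls x) = 0"
  using td_le_chain[of "[x]" "cls x" "cls x"] td_nonneg[of x x] ten_class_self[of x X S]
  by (simp add: chain_cost_single)

lemma td_le_2:
  assumes "x \<in> Mset \<times> X" "y \<in> Mset \<times> X"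
  shows "td (cls x) (cls y) \<le> 2"
proof -
  have "td (cls x) (cls y) \<le> chain_cost [x, y]"
    by (rule td_le_chain) (use assms in auto)
  also have "\<dots> \<le> 2"
    using chain_cost_snoc[of "[x]" y] assms d_le_2[of "snd x" "snd y"]
    by (auto simp: chain_cost_single ten_d0_def)
  finally show ?thesis .
qed

text \<open>A chain ending in the class of \<open>(m, x)\<close> is prolonged by
  \<open>(m, x)\<close> itself, at no cost, and then by \<open>(m, y)\<close>. This makes the
  distance from a fixed point a legitimate potential for \<open>td_lower\<close>.\<close>

lemma td_step:
  assumes "u \<in> Mset \<times> X" "m \<in> Mset" "x \<in> X" "y \<in> X"
  shows "td (cls u) (cls (m, y)) \<le> td (cls u) (cls (m, x)) + d x y / 3"
proof -
  have "td (cls u) (cls (m, y)) - d x y / 3 \<le> chain_cost xs"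
    if xs: "xs \<noteq> []" "set xs \<subseteq> Mset \<times> X" "hd xs \<in> cls u" "last xs \<in> cls (m, x)" for xs
  proof -
    have "td (cls u) (cls (m, y)) \<le> chain_cost ((xs @ [(m, x)]) @ [(m, y)])"
      by (rule td_le_chain) (use assms xs in auto)
    also have "\<dots> \<le> chain_cost xs + d x y / 3"
    proof -
      have "(last xs, (m, x)) \<in> ten_rel X S"
        using in_ten_class[OF xs(4)] symD[OF sym_ten_rel] by blast
      thus ?thesis
        using chain_cost_snoc[of "xs @ [(m, x)]" "(m, y)"] chain_cost_snoc[OF xs(1), of "(m, x)"]
          d_nonneg[OF assms(3,4)] by (auto simp: ten_d0_def)
    qed
    finally show ?thesis by simp
  qed
  hence "td (cls u) (cls (m, y)) - d x y / 3 \<le> td (cls u) (cls (m, x))"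
    unfolding ten_dist_alt[of "cls u" "cls (m, x)"]
    by (intro cInf_greatest) (use assms in \<open>auto intro!: exI[of _ "[u,(m,x)]"]\<close>)
  thus ?thesis by simp
qed

text \<open>No concatenation of chains: \<open>td_lower\<close> is applied to the distance from
  \<open>x\<close>. The minimum with 2 is harmless since that distance never exceeds 2.\<close>

lemma td_triangle:
  assumes "x \<in> Mset \<times> X" "y \<in> Mset \<times> X" "z \<in> Mset \<times> X"
  shows "td (cls x) (cls z) \<le> td (cls x) (cls y) + td (cls y) (cls z)"
proof -
  have "min 2 (td (cls x) (cls z) - td (cls x) (cls y)) \<le> td (cls y) (cls z)"
  proof (rule td_lower[of "\<lambda>z. td (cls x) (cls z)"])
    fix m a b assume m: "m \<in> Mset" "a \<in> X" "b \<in> X"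
    show "td (cls x) (cls (m, b)) - td (cls x) (cls (m, a)) \<le> d a b / 3"
      using td_step[OF assms(1) m] by simp
  qed (use assms compatible_cls in auto)
  thus ?thesis using td_le_2[OF assms(1,3)] td_nonneg[OF assms(1,2)] by simp
qed

lemma td_same_cell:
  assumes "m \<in> Mset" "x \<in> X" "y \<in> X"
  shows "td (cls (m, x)) (cls (m, y)) \<le> d x y / 3"
  using td_step[of "(m, x)" m x y] td_self[of "(m, x)"] assms by simp

end

section \<open>Lower bounds and separation\<close>

text \<open>The distance from \<open>m \<otimes> f x\<close>, pulled back along \<open>f\<close>, is
  an admissible potential on the source; preservation of the boundary makes it compatible.\<close>

lemma ten_dist_short_map:
  assumes "squams X d S" "squams Y d' S'" "f ` X \<subseteq> Y"
    and short: "\<And>x y. x \<in> X \<Longrightarrow> y \<in> X \<Longrightarrow> d' (f x) (f y) \<le> d x y"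
    and boundary: "\<And>p. p \<in> M0 \<Longrightarrow> f (S p) = S' p"
    and m: "m \<in> Mset" "x \<in> X" and n: "n \<in> Mset" "y \<in> X"
  shows "ten_dist Y d' S' (ten_class Y S' (m, f x)) (ten_class Y S' (n, f y))
    \<le> ten_dist X d S (ten_class X S (m, x)) (ten_class X S (n, y))"
proof -
  interpret X: squams_space X d S by unfold_locales fact
  interpret Y: squams_space Y d' S' by unfold_locales fact
  have f: "f x \<in> Y" if "x \<in> X" for x using assms(3) that by auto
  define g where "g z = Y.td (Y.cls (m, f x)) (Y.cls (fst z, f (snd z)))" for z
  have "min 2 (g (n, y) - g (m, x)) \<le> X.td (X.cls (m, x)) (X.cls (n, y))"
  proof (rule X.td_lower)
    show "compatible S g"
      unfolding compatible_def g_def by (auto simp: boundary intro!: arg_cong[OF Y.ten_glue])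
    fix k a b assume k: "k \<in> Mset" "a \<in> X" "b \<in> X"
    have "g (k, b) - g (k, a) \<le> d' (f a) (f b) / 3"
      using Y.td_step[of "(m, f x)" k "f a" "f b"] m k f by (simp add: g_def)
    thus "g (k, b) - g (k, a) \<le> d a b / 3" using short[of a b] k by simp
  qed (use m n in auto)
  moreover have "g (m, x) = 0" "g (n, y) \<le> 2"
    using Y.td_self[of "(m, f x)"] Y.td_le_2[of "(m, f x)" "(n, f y)"] m n f by (auto simp: g_def)
  ultimately show ?thesis by (simp add: g_def)
qed

section \<open>McShane extensions and taxicab detours\<close>

context squams_space
begin

text \<open>The largest 1-Lipschitz function whose value at each \<open>w z\<close> is at most
  \<open>c z\<close>, provided \<open>Z\<close> is nonempty and \<open>c\<close> is bounded below.
  Indexing by \<open>Z\<close> rather than by points lets several indices name the same point, as in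
  \<open>detour\<close>.\<close>

definition mcshane :: "'z set \<Rightarrow> ('z \<Rightarrow> real) \<Rightarrow> ('z \<Rightarrow> 'a) \<Rightarrow> 'a \<Rightarrow> real" where
  "mcshane Z c w x = (INF z\<in>Z. c z + d (w z) x)"

lemma mcshane_bdd:
  assumes "\<And>z. z \<in> Z \<Longrightarrow> w z \<in> X" "\<And>z. z \<in> Z \<Longrightarrow> B \<le> c z" "x \<in> X"
  shows "bdd_below ((\<lambda>z. c z + d (w z) x) ` Z)"
proof (rule bdd_belowI2[of _ B])
  fix z assume "z \<in> Z"
  thus "B \<le> c z + d (w z) x" using assms(2)[of z] d_nonneg[OF assms(1) assms(3), of z] by simp
qed

lemma mcshane_le:
  assumes "\<And>z. z \<in> Z \<Longrightarrow> w z \<in> X" "\<And>z. z \<in> Z \<Longrightarrow> B \<le> c z" "x \<in> X" "z \<in> Z"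
  shows "mcshane Z c w x \<le> c z + d (w z) x"
  unfolding mcshane_def using mcshane_bdd[OF assms(1-3)] assms(4) by (intro cINF_lower) auto

lemma mcshane_ge:
  assumes "Z \<noteq> {}" "\<And>z. z \<in> Z \<Longrightarrow> B \<le> c z + d (w z) x"
  shows "B \<le> mcshane Z c w x"
  unfolding mcshane_def using assms by (intro cINF_greatest) auto

lemma mcshane_lipschitz:
  assumes Z: "Z \<noteq> {}" and w: "\<And>z. z \<in> Z \<Longrightarrow> w z \<in> X" and c: "\<And>z. z \<in> Z \<Longrightarrow> B \<le> c z"
    and "x \<in> X" "y \<in> X"
  shows "mcshane Z c w y - mcshane Z c w x \<le> d x y"
proof -
  have "mcshane Z c w y - d x y \<le> mcshane Z c w x"
  proof (rule mcshane_ge[OF Z])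
    fix z assume z: "z \<in> Z"
    have "mcshane Z c w y \<le> c z + d (w z) y" by (rule mcshane_le[OF w c]) (use assms z in auto)
    thus "mcshane Z c w y - d x y \<le> c z + d (w z) x"
      using d_triangle[of "w z" x y] w[OF z] assms(4,5) by simp
  qed
  thus ?thesis by simp
qed

lemma mcshane_extends:
  assumes w: "\<And>z. z \<in> Z \<Longrightarrow> w z \<in> X" and c: "\<And>z. z \<in> Z \<Longrightarrow> B \<le> c z" and z: "z \<in> Z"
    and lip: "\<And>z'. z' \<in> Z \<Longrightarrow> c z - c z' \<le> d (w z') (w z)"
  shows "mcshane Z c w (w z) = c z"
proof (rule antisym)
  show "mcshane Z c w (w z) \<le> c z"
    using mcshane_le[of Z w B c, OF w c w[OF z] z] w[OF z] by simp
  show "c z \<le> mcshane Z c w (w z)"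
    by (rule mcshane_ge) (use z lip in \<open>auto simp: algebra_simps\<close>)
qed

text \<open>The length of a shortest detour from \<open>m \<otimes> a\<close> to \<open>n \<otimes> b\<close> that moves from the
  boundary of the first cell to that of the second one in the taxicab metric of the plane.\<close>

definition detour :: "nat \<times> nat \<Rightarrow> 'a \<Rightarrow> nat \<times> nat \<Rightarrow> 'a \<Rightarrow> real" where
  "detour m a n = mcshane (M0 \<times> M0)
     (\<lambda>z. d a (S (snd z)) + taxi (shift n (fst z)) (shift m (snd z))) (S \<circ> fst)"

definition reach :: "nat \<times> nat \<Rightarrow> 'a \<Rightarrow> real \<times> real \<Rightarrow> real" where
  "reach m a P = (INF q\<in>M0. d a (S q) + taxi P (shift m q))"

lemma reach_le:
  assumes "a \<in> X" "q \<in> M0"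
  shows "reach m a P \<le> d a (S q) + taxi P (shift m q)"
  unfolding reach_def
  by (rule cINF_lower) (use assms d_nonneg taxi_nonneg in \<open>auto intro!: bdd_belowI2[of _ 0] add_nonneg_nonneg\<close>)

text \<open>Leaving the cell and returning saves nothing below 1: either the taxicab part already
  costs 1, or it bounds the inner distance by \<open>S_dist_near\<close>. This is where the
  truncation at 1 comes from.\<close>

lemma reach_same_cell:
  assumes "a \<in> X" "p \<in> M0"
  shows "min 1 (reach m a (shift m p)) = min 1 (d a (S p))"
proof -
  have "min 1 (d a (S p)) \<le> reach m a (shift m p)"
    unfolding reach_def
  proof (rule cINF_greatest)
    fix q assume q: "q \<in> M0"
    show "min 1 (d a (S p)) \<le> d a (S q) + taxi (shift m p) (shift m q)"
    proof (cases "taxi p q < 1")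
      case True
      thus ?thesis using S_dist_near[of q p] d_triangle[of a "S q" "S p"] assms q
        by (simp add: taxi_commute)
    next
      case False
      thus ?thesis using d_nonneg[of a "S q"] assms q by simp
    qed
  qed (use assms in auto)
  moreover have "reach m a (shift m p) \<le> d a (S p)"
    using reach_le[OF assms, of m "shift m p"] by simp
  ultimately show ?thesis by (auto simp: min_def)
qed

text \<open>On the boundary of the target cell the inner distance dominates the taxicab one, so it
  is best to go straight to \<open>S p\<close> in the plane. The value depends only on the position
  of that point, which yields compatibility.\<close>

lemma detour_boundary:
  assumes "a \<in> X" "p \<in> M0"
  shows "detour m a n (S p) = reach m a (shift n p)"
proof (rule antisym)
  have nn: "0 \<le> d a (S (snd z)) + taxi (shift n (fst z)) (shift m (snd z))" if "z \<in> M0 \<times> M0" for z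
    using that assms d_nonneg[of a "S (snd z)"] taxi_nonneg by (auto intro: add_nonneg_nonneg)
  show "detour m a n (S p) \<le> reach m a (shift n p)"
    unfolding reach_def
  proof (rule cINF_greatest)
    fix q assume "q \<in> M0"
    thus "detour m a n (S p) \<le> d a (S q) + taxi (shift n p) (shift m q)"
      using mcshane_le[of "M0 \<times> M0" "S \<circ> fst" 0
          "\<lambda>z. d a (S (snd z)) + taxi (shift n (fst z)) (shift m (snd z))" "S p" "(p, q)"]
        nn assms by (auto simp: detour_def)
  qed (use assms in auto)
  show "reach m a (shift n p) \<le> detour m a n (S p)"
    unfolding detour_def
  proof (rule mcshane_ge)
    fix z assume z: "z \<in> M0 \<times> M0"
    have "reach m a (shift n p) \<le> d a (S (snd z)) + taxi (shift n p) (shift m (snd z))"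
      by (rule reach_le) (use z assms in auto)
    moreover have "taxi (shift n p) (shift m (snd z)) \<le>
        taxi p (fst z) + taxi (shift n (fst z)) (shift m (snd z))"
      using taxi_triangle[of "shift n p" "shift m (snd z)" "shift n (fst z)"] by simp
    moreover have "taxi p (fst z) \<le> d (S (fst z)) (S p)"
      using taxi_le_d[of "fst z" p] z assms by (auto simp: taxi_commute)
    ultimately show "reach m a (shift n p) \<le>
        d a (S (snd z)) + taxi (shift n (fst z)) (shift m (snd z)) + d ((S \<circ> fst) z) (S p)" by simp
  qed (use assms in auto)
qed

text \<open>The inner distance on cell \<open>m\<close> and the detour length elsewhere, truncated
  at 1, agree on shared boundaries and form one potential. The case \<open>n = m\<close> shows that
  a cell is embedded with exact scale 1/3 for distances below 1; the other case serves
  separation.\<close>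

lemma td_lower_detour:
  assumes "m \<in> Mset" "a \<in> X" "n \<in> Mset" "b \<in> X"
  shows "(if n = m then min 1 (d a b) else min 1 (detour m a n b)) / 3 \<le> td (cls (m, a)) (cls (n, b))"
proof -
  define g where "g z = (if fst z = m then min 1 (d a (snd z)) else min 1 (detour m a (fst z) (snd z))) / 3" for z
  have gS: "g (k, S p) = min 1 (reach m a (shift k p)) / 3" if "p \<in> M0" for k p
    using that assms by (auto simp: g_def detour_boundary reach_same_cell)
  have "min 2 (g (n, b) - g (m, a)) \<le> td (cls (m, a)) (cls (n, b))"
  proof (rule td_lower)
    show "compatible S g" by (auto simp: compatible_def gS)
    fix k x y assume k: "k \<in> Mset" "x \<in> X" "y \<in> X"
    have nn: "0 \<le> d a (S (snd z)) + taxi (shift k (fst z)) (shift m (snd z))" if "z \<in> M0 \<times> M0" for z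
      using that assms d_nonneg[of a "S (snd z)"] taxi_nonneg by (auto intro: add_nonneg_nonneg)
    have 1: "detour m a k y - detour m a k x \<le> d x y"
      unfolding detour_def
      by (rule mcshane_lipschitz[of _ _ 0]) (use k nn in \<open>auto intro: M0_corner\<close>)
    have 2: "d a y - d a x \<le> d x y" using d_triangle[of a x y] assms k by simp
    have "0 \<le> d x y" using d_nonneg k by simp
    thus "g (k, y) - g (k, x) \<le> d x y / 3" using 1 2 by (auto simp: g_def min_def)
  qed (use assms in auto)
  moreover have "g (m, a) = 0" using assms by (simp add: g_def)
  moreover have "g (n, b) \<le> 2" by (auto simp: g_def)
  ultimately show ?thesis by (cases "n = m") (simp_all add: g_def)
qed

lemma continuous_dist_S: "a \<in> X \<Longrightarrow> continuous_on M0 (\<lambda>p. d a (S p))"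
proof (rule continuous_onI)
  fix p and e :: real assume a: "a \<in> X" and p: "p \<in> M0" and e: "0 < e"
  show "\<exists>\<delta>>0. \<forall>q\<in>M0. dist q p < \<delta> \<longrightarrow> dist (d a (S q)) (d a (S p)) \<le> e"
  proof (intro exI[of _ "e/4"] conjI ballI impI)
    fix q assume q: "q \<in> M0" "dist q p < e / 4"
    have "taxi q p \<le> 2 * dist q p"
      using dist_fst_le[of q p] dist_snd_le[of q p] by (simp add: taxi_def dist_real_def)
    hence "d (S q) (S p) \<le> e" using S_dist_le_2_taxi[OF q(1) p] q by simp
    thus "dist (d a (S q)) (d a (S p)) \<le> e"
      using d_triangle[of a "S q" "S p"] d_triangle[of a "S p" "S q"] d_commute[of "S p" "S q"] a p q
      by (simp add: dist_real_def)
  qed (use e in auto)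
qed

text \<open>Compactness of \<open>M0\<close> turns the infimum into a minimum, so that a detour of
  length 0 produces actual gluing points.\<close>

lemma detour_attained:
  assumes "a \<in> X" "b \<in> X"
  obtains p q where "p \<in> M0" "q \<in> M0"
    "detour m a n b = d a (S q) + taxi (shift n p) (shift m q) + d (S p) b"
proof -
  define f where "f z = d a (S (snd z)) + taxi (shift n (fst z)) (shift m (snd z)) + d b (S (fst z))" for z
  have c1: "continuous_on (M0 \<times> M0) (\<lambda>z. d a (S (snd z)))"
    by (rule continuous_on_compose2[OF continuous_dist_S[OF assms(1)]]) (auto intro: continuous_intros)
  have c2: "continuous_on (M0 \<times> M0) (\<lambda>z. d b (S (fst z)))"
    by (rule continuous_on_compose2[OF continuous_dist_S[OF assms(2)]]) (auto intro: continuous_intros)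
  have "continuous_on (M0 \<times> M0) f"
    unfolding f_def taxi_def shift_def by (intro continuous_intros c1 c2)
  then obtain z where z: "z \<in> M0 \<times> M0" "\<And>y. y \<in> M0 \<times> M0 \<Longrightarrow> f z \<le> f y"
    using continuous_attains_inf[of "M0 \<times> M0" f] compact_M0 compact_Times M0_corner by blast
  have f: "f y = d a (S (snd y)) + taxi (shift n (fst y)) (shift m (snd y)) + d ((S \<circ> fst) y) b"
    if "y \<in> M0 \<times> M0" for y using that assms d_commute[of b "S (fst y)"] by (auto simp: f_def)
  have "detour m a n b = f z"
    unfolding detour_def mcshane_def using z f by (intro cInf_eq_minimum) auto
  thus ?thesis using z f that[of "fst z" "snd z"] by (auto simp: mem_Times_iff)
qed

text \<open>In different cells all three parts of a minimal detour vanish: both points lie on their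
  cell boundaries and at the same position, hence are glued.\<close>

lemma td_eq_0_imp:
  assumes u: "m \<in> Mset" "a \<in> X" and v: "n \<in> Mset" "b \<in> X"
    and 0: "td (cls (m, a)) (cls (n, b)) \<le> 0"
  shows "cls (m, a) = cls (n, b)"
proof (cases "n = m")
  case True
  thus ?thesis using td_lower_detour[OF u v] 0 d_nonneg[OF u(2) v(2)] d_eq_0_iff[OF u(2) v(2)]
    by (auto simp: min_def split: if_splits)
next
  case False
  obtain p q where pq: "p \<in> M0" "q \<in> M0"
    "detour m a n b = d a (S q) + taxi (shift n p) (shift m q) + d (S p) b"
    using detour_attained[OF u(2) v(2)] by blast
  have "detour m a n b \<le> 0"
    using td_lower_detour[OF u v] 0 False by (auto simp: min_def split: if_splits)
  moreover have "0 \<le> d a (S q)" "0 \<le> d (S p) b" "0 \<le> taxi (shift n p) (shift m q)"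
    using pq u v d_nonneg taxi_nonneg by auto
  ultimately have "d a (S q) = 0" "d (S p) b = 0" "taxi (shift n p) (shift m q) = 0"
    using pq(3) by linarith+
  hence "a = S q" "S p = b" "shift n p = shift m q"
    using pq u v by (auto simp: d_eq_0_iff taxi_eq_0_iff)
  thus ?thesis using ten_glue[of m n q p] u v pq by simp
qed

end

section \<open>Completion\<close>

context metric_set
begin

abbreviation cauchy where "cauchy \<equiv> cauchy_seqs X d"
abbreviation ccls where "ccls \<sigma> \<equiv> cs_rel X d `` {\<sigma>}"
abbreviation cx where "cx \<equiv> C_carrier X d"
abbreviation cd where "cd \<equiv> C_dist d"
abbreviation emb where "emb x \<equiv> ccls (\<lambda>_. x)"

lemma cauchy_in: "\<sigma> \<in> cauchy \<Longrightarrow> \<sigma> n \<in> X"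
  by (auto simp: cauchy_seqs_def)

lemma cauchyD: "\<sigma> \<in> cauchy \<Longrightarrow> 0 < e \<Longrightarrow> \<exists>N. \<forall>n n'. N \<le> n \<longrightarrow> N \<le> n' \<longrightarrow> d (\<sigma> n) (\<sigma> n') < e"
  by (auto simp: cauchy_seqs_def)

lemma d_quadrilateral:
  assumes "x \<in> X" "y \<in> X" "x' \<in> X" "y' \<in> X"
  shows "\<bar>d x y - d x' y'\<bar> \<le> d x x' + d y y'"
  using d_triangle[of x x' y] d_triangle[of x' y' y] d_triangle[of x' x y'] d_triangle[of x y y']
    d_commute[of x x'] d_commute[of y y'] assms by linarith

lemma dist_convergent:
  assumes "\<sigma> \<in> cauchy" "\<tau> \<in> cauchy"
  shows "convergent (\<lambda>n. d (\<sigma> n) (\<tau> n))"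
proof (rule Cauchy_convergent, rule metric_CauchyI)
  fix e :: real assume e: "0 < e"
  obtain N where N: "\<And>n n'. N \<le> n \<Longrightarrow> N \<le> n' \<Longrightarrow> d (\<sigma> n) (\<sigma> n') < e/2"
    using cauchyD[OF assms(1), of "e/2"] e by auto
  obtain N' where N': "\<And>n n'. N' \<le> n \<Longrightarrow> N' \<le> n' \<Longrightarrow> d (\<tau> n) (\<tau> n') < e/2"
    using cauchyD[OF assms(2), of "e/2"] e by auto
  show "\<exists>M. \<forall>m\<ge>M. \<forall>n\<ge>M. dist (d (\<sigma> m) (\<tau> m)) (d (\<sigma> n) (\<tau> n)) < e"
  proof (intro exI[of _ "max N N'"] allI impI)
    fix m n assume "max N N' \<le> m" "max N N' \<le> n"
    thus "dist (d (\<sigma> m) (\<tau> m)) (d (\<sigma> n) (\<tau> n)) < e"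
      using N[of m n] N'[of m n] d_quadrilateral[of "\<sigma> m" "\<tau> m" "\<sigma> n" "\<tau> n"] assms
      by (simp add: dist_real_def cauchy_in)
  qed
qed

lemma null_dist_triangle:
  assumes "(\<lambda>n. d (x n) (y n)) \<longlonglongrightarrow> 0" "(\<lambda>n. d (y n) (z n)) \<longlonglongrightarrow> 0"
    and "\<And>n. x n \<in> X" "\<And>n. y n \<in> X" "\<And>n. z n \<in> X"
  shows "(\<lambda>n. d (x n) (z n)) \<longlonglongrightarrow> 0"
proof (rule tendsto_sandwich[OF _ _ tendsto_const])
  show "(\<lambda>n. d (x n) (y n) + d (y n) (z n)) \<longlonglongrightarrow> 0" using tendsto_add[OF assms(1,2)] by simp
qed (use assms d_nonneg d_triangle in auto)

lemma equiv_cs_rel: "equiv cauchy (cs_rel X d)"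
proof (rule equivI)
  show "cs_rel X d \<subseteq> cauchy \<times> cauchy" by (auto simp: cs_rel_def)
  show "refl_on cauchy (cs_rel X d)" by (auto simp: cs_rel_def refl_on_def cauchy_in)
  show "sym (cs_rel X d)"
  proof (rule symI)
    fix \<sigma> \<tau> assume "(\<sigma>, \<tau>) \<in> cs_rel X d"
    moreover have "(\<lambda>n. d (\<sigma> n) (\<tau> n)) = (\<lambda>n. d (\<tau> n) (\<sigma> n))" if "\<sigma> \<in> cauchy" "\<tau> \<in> cauchy"
      using that by (intro ext d_commute cauchy_in)
    ultimately show "(\<tau>, \<sigma>) \<in> cs_rel X d" by (auto simp: cs_rel_def)
  qed
  show "trans (cs_rel X d)"
  proof (rule transI)
    fix \<sigma> \<tau> \<rho> assume "(\<sigma>, \<tau>) \<in> cs_rel X d" "(\<tau>, \<rho>) \<in> cs_rel X d"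
    thus "(\<sigma>, \<rho>) \<in> cs_rel X d"
      by (auto simp: cs_rel_def cauchy_in intro: null_dist_triangle[of \<sigma> \<tau> \<rho>])
  qed
qed

lemma ccls_eq_iff:
  "\<sigma> \<in> cauchy \<Longrightarrow> \<tau> \<in> cauchy \<Longrightarrow> ccls \<sigma> = ccls \<tau> \<longleftrightarrow> (\<lambda>n. d (\<sigma> n) (\<tau> n)) \<longlonglongrightarrow> 0"
  using eq_equiv_class_iff[OF equiv_cs_rel, of \<sigma> \<tau>] by (auto simp: cs_rel_def)

lemma ccls_in: "\<sigma> \<in> cauchy \<Longrightarrow> ccls \<sigma> \<in> cx"
  by (simp add: C_carrier_def quotientI)

lemma cx_cases:
  assumes "q \<in> cx" obtains \<sigma> where "\<sigma> \<in> cauchy" "q = ccls \<sigma>"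
  using assms by (auto simp: C_carrier_def quotient_def)

lemma ccls_some:
  assumes "\<sigma> \<in> cauchy"
  shows "(SOME \<tau>. \<tau> \<in> ccls \<sigma>) \<in> cauchy" "(\<lambda>n. d (\<sigma> n) ((SOME \<tau>. \<tau> \<in> ccls \<sigma>) n)) \<longlonglongrightarrow> 0"
proof -
  have "\<sigma> \<in> ccls \<sigma>" using equiv_class_self[OF equiv_cs_rel assms] .
  hence "(SOME \<tau>. \<tau> \<in> ccls \<sigma>) \<in> ccls \<sigma>" by (rule someI[of "\<lambda>\<tau>. \<tau> \<in> ccls \<sigma>"])
  thus "(SOME \<tau>. \<tau> \<in> ccls \<sigma>) \<in> cauchy" "(\<lambda>n. d (\<sigma> n) ((SOME \<tau>. \<tau> \<in> ccls \<sigma>) n)) \<longlonglongrightarrow> 0"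
    by (auto simp: cs_rel_def)
qed

text \<open>Frees \<open>C_dist\<close> from its chosen representatives: exchanging them alters the
  distances by a null sequence.\<close>

lemma cd_tendsto:
  assumes "\<sigma> \<in> cauchy" "\<tau> \<in> cauchy"
  shows "(\<lambda>n. d (\<sigma> n) (\<tau> n)) \<longlonglongrightarrow> cd (ccls \<sigma>) (ccls \<tau>)"
proof -
  let ?s = "SOME \<rho>. \<rho> \<in> ccls \<sigma>" let ?t = "SOME \<rho>. \<rho> \<in> ccls \<tau>"
  note s = ccls_some[OF assms(1)] and t = ccls_some[OF assms(2)]
  have l: "(\<lambda>n. d (?s n) (?t n)) \<longlonglongrightarrow> cd (ccls \<sigma>) (ccls \<tau>)"
    using dist_convergent[OF s(1) t(1)] by (simp add: C_dist_def convergent_LIMSEQ_iff)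
  have "(\<lambda>n. d (\<sigma> n) (\<tau> n) - d (?s n) (?t n)) \<longlonglongrightarrow> 0"
  proof (rule Lim_null_comparison)
    show "(\<lambda>n. d (\<sigma> n) (?s n) + d (\<tau> n) (?t n)) \<longlonglongrightarrow> 0" using tendsto_add[OF s(2) t(2)] by simp
    show "\<forall>\<^sub>F n in sequentially. norm (d (\<sigma> n) (\<tau> n) - d (?s n) (?t n)) \<le> d (\<sigma> n) (?s n) + d (\<tau> n) (?t n)"
      using d_quadrilateral assms s(1) t(1) by (simp add: cauchy_in)
  qed
  from tendsto_add[OF this l] show ?thesis by simp
qed

lemma const_cauchy: "x \<in> X \<Longrightarrow> (\<lambda>_. x) \<in> cauchy"
  by (auto simp: cauchy_seqs_def)

lemma emb_in: "x \<in> X \<Longrightarrow> emb x \<in> cx"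
  by (simp add: ccls_in const_cauchy)

lemma cd_emb:
  assumes "x \<in> X" "y \<in> X" shows "cd (emb x) (emb y) = d x y"
  using LIMSEQ_unique[OF cd_tendsto[OF const_cauchy const_cauchy] tendsto_const] assms by simp

lemma cd_le:
  assumes "\<sigma> \<in> cauchy" "\<tau> \<in> cauchy" "\<And>n. N \<le> n \<Longrightarrow> d (\<sigma> n) (\<tau> n) \<le> B"
  shows "cd (ccls \<sigma>) (ccls \<tau>) \<le> B"
  by (rule LIMSEQ_le_const2[OF cd_tendsto]) (use assms in auto)

lemma metric_completion: "metric_on cx cd"
  unfolding metric_on_def
proof (intro conjI ballI)
  fix x y assume "x \<in> cx" "y \<in> cx"
  then obtain \<sigma> \<tau> where x: "\<sigma> \<in> cauchy" "x = ccls \<sigma>" and y: "\<tau> \<in> cauchy" "y = ccls \<tau>"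
    by (metis cx_cases)
  note l = cd_tendsto[OF x(1) y(1)]
  show "0 \<le> cd x y"
    unfolding x y by (rule LIMSEQ_le_const[OF l]) (use x y d_nonneg cauchy_in in auto)
  have "(\<lambda>n. d (\<sigma> n) (\<tau> n)) = (\<lambda>n. d (\<tau> n) (\<sigma> n))"
    using x y by (intro ext d_commute cauchy_in)
  thus "cd x y = cd y x"
    unfolding x y using LIMSEQ_unique[OF l, of "cd (ccls \<tau>) (ccls \<sigma>)"] cd_tendsto[OF y(1) x(1)] by simp
  show "cd x y = 0 \<longleftrightarrow> x = y"
    using ccls_eq_iff[OF x(1) y(1)] l LIMSEQ_unique[OF l, of 0] x y by auto
next
  fix x y z assume "x \<in> cx" "y \<in> cx" "z \<in> cx"
  then obtain \<sigma> \<tau> \<rho> where x: "\<sigma> \<in> cauchy" "x = ccls \<sigma>" and y: "\<tau> \<in> cauchy" "y = ccls \<tau>"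
    and z: "\<rho> \<in> cauchy" "z = ccls \<rho>" by (metis cx_cases)
  show "cd x z \<le> cd x y + cd y z"
    unfolding x y z
    by (rule LIMSEQ_le[OF cd_tendsto tendsto_add[OF cd_tendsto cd_tendsto]])
      (use x y z d_triangle cauchy_in in auto)
qed

end

context metric_set
begin

interpretation completion: metric_set "C_carrier X d" "C_dist d"
  by unfold_locales (rule metric_completion)

lemma emb_tendsto:
  assumes "\<sigma> \<in> cauchy"
  shows "(\<lambda>k. cd (emb (\<sigma> k)) (ccls \<sigma>)) \<longlonglongrightarrow> 0"
proof (rule LIMSEQ_I)
  fix e :: real assume e: "0 < e"
  obtain N where N: "\<And>n n'. N \<le> n \<Longrightarrow> N \<le> n' \<Longrightarrow> d (\<sigma> n) (\<sigma> n') < e/2"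
    using cauchyD[OF assms, of "e/2"] e by auto
  show "\<exists>no. \<forall>n\<ge>no. norm (cd (emb (\<sigma> n)) (ccls \<sigma>) - 0) < e"
  proof (intro exI[of _ N] allI impI)
    fix n assume "N \<le> n"
    hence "cd (emb (\<sigma> n)) (ccls \<sigma>) \<le> e/2"
      using N assms by (intro cd_le[of _ _ N] const_cauchy cauchy_in) (auto intro: less_imp_le)
    moreover have "0 \<le> cd (emb (\<sigma> n)) (ccls \<sigma>)"
      using assms by (intro completion.d_nonneg emb_in ccls_in cauchy_in)
    ultimately show "norm (cd (emb (\<sigma> n)) (ccls \<sigma>) - 0) < e" using e by simp
  qed
qed

lemma emb_dense:
  assumes "q \<in> cx" "0 < e"
  obtains x where "x \<in> X" "cd q (emb x) < e"
proof -
  obtain \<sigma> where s: "\<sigma> \<in> cauchy" "q = ccls \<sigma>" using assms(1) by (rule cx_cases)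
  obtain k where k: "\<forall>n\<ge>k. norm (cd (emb (\<sigma> n)) (ccls \<sigma>) - 0) < e"
    using LIMSEQ_D[OF emb_tendsto[OF s(1)] assms(2)] by blast
  have "cd (emb (\<sigma> k)) q < e"
    using k[rule_format, of k] s(2) by (simp add: abs_less_iff)
  moreover have "cd (emb (\<sigma> k)) q = cd q (emb (\<sigma> k))"
    using s assms by (intro completion.d_commute emb_in cauchy_in)
  ultimately show ?thesis using that[of "\<sigma> k"] s cauchy_in by simp
qed

text \<open>Each \<open>s k\<close> is approximated within \<open>1/(k+1)\<close> by an embedded
  point \<open>\<tau> k\<close>; the sequence \<open>\<tau>\<close> is Cauchy and its own class is
  the limit.\<close>

lemma completion_complete:
  assumes s: "s \<in> cauchy_seqs cx cd"
  obtains q where "q \<in> cx" "(\<lambda>k. cd (s k) q) \<longlonglongrightarrow> 0"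
proof -
  have sin: "s k \<in> cx" for k using s by (rule completion.cauchy_in)
  have "\<exists>x. x \<in> X \<and> cd (s k) (emb x) < inverse (real (Suc k))" for k
    using emb_dense[OF sin[of k], of "inverse (real (Suc k))"] by (metis inverse_positive_iff_positive of_nat_0_less_iff zero_less_Suc)
  then obtain \<tau> where t: "\<And>k. \<tau> k \<in> X" "\<And>k. cd (s k) (emb (\<tau> k)) < inverse (real (Suc k))" by metis
  have lim: "(\<lambda>k. cd (s k) (emb (\<tau> k))) \<longlonglongrightarrow> 0"
    by (rule tendsto_sandwich[OF _ _ tendsto_const LIMSEQ_inverse_real_of_nat])
      (intro always_eventually allI completion.d_nonneg sin emb_in t(1) less_imp_le[OF t(2)])+
  have "\<tau> \<in> cauchy"
    unfolding cauchy_seqs_def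
  proof (intro CollectI conjI allI impI)
    show "range \<tau> \<subseteq> X" using t by auto
    fix e :: real assume e: "0 < e"
    obtain N where N: "\<And>n n'. N \<le> n \<Longrightarrow> N \<le> n' \<Longrightarrow> cd (s n) (s n') < e/3"
      using completion.cauchyD[OF s, of "e/3"] e by auto
    obtain N' where N': "\<And>n. N' \<le> n \<Longrightarrow> \<bar>cd (s n) (emb (\<tau> n))\<bar> < e/3"
      using LIMSEQ_D[OF lim, of "e/3"] e by auto
    show "\<exists>N. \<forall>n n'. N \<le> n \<longrightarrow> N \<le> n' \<longrightarrow> d (\<tau> n) (\<tau> n') < e"
    proof (intro exI[of _ "max N N'"] allI impI)
      fix n n' assume n: "max N N' \<le> n" "max N N' \<le> n'"
      have "d (\<tau> n) (\<tau> n') = cd (emb (\<tau> n)) (emb (\<tau> n'))" using t by (simp add: cd_emb)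
      also have "\<dots> < e"
        using completion.d_quadrilateral[of "s n" "s n'" "emb (\<tau> n)" "emb (\<tau> n')"]
          N[of n n'] N'[of n] N'[of n'] n sin t emb_in by simp
      finally show "d (\<tau> n) (\<tau> n') < e" .
    qed
  qed
  hence "(\<lambda>k. cd (s k) (ccls \<tau>)) \<longlonglongrightarrow> 0"
    using completion.null_dist_triangle[OF lim emb_tendsto] sin t emb_in ccls_in by auto
  thus ?thesis using that[of "ccls \<tau>"] ccls_in[OF \<open>\<tau> \<in> cauchy\<close>] by blast
qed

text \<open>Needed because \<open>canon\<close> passes to the subsequence lying in one cell.\<close>

lemma subseq_cauchy:
  assumes "\<sigma> \<in> cauchy" "strict_mono r"
  shows "\<sigma> \<circ> r \<in> cauchy" "ccls (\<sigma> \<circ> r) = ccls \<sigma>"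
proof -
  have r: "n \<le> r n" for n using seq_suble[OF assms(2)] .
  show c: "\<sigma> \<circ> r \<in> cauchy"
    unfolding cauchy_seqs_def
  proof (intro CollectI conjI allI impI)
    show "range (\<sigma> \<circ> r) \<subseteq> X" using cauchy_in[OF assms(1)] by auto
    fix e :: real assume "0 < e"
    then obtain N where N: "\<And>n n'. N \<le> n \<Longrightarrow> N \<le> n' \<Longrightarrow> d (\<sigma> n) (\<sigma> n') < e"
      using cauchyD[OF assms(1)] by metis
    show "\<exists>N. \<forall>n n'. N \<le> n \<longrightarrow> N \<le> n' \<longrightarrow> d ((\<sigma> \<circ> r) n) ((\<sigma> \<circ> r) n') < e"
      using N r by (intro exI[of _ N]) (auto intro: order_trans)
  qed
  have "(\<lambda>n. d ((\<sigma> \<circ> r) n) (\<sigma> n)) \<longlonglongrightarrow> 0"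
  proof (rule LIMSEQ_I)
    fix e :: real assume "0 < e"
    then obtain N where N: "\<And>n n'. N \<le> n \<Longrightarrow> N \<le> n' \<Longrightarrow> d (\<sigma> n) (\<sigma> n') < e"
      using cauchyD[OF assms(1)] by metis
    show "\<exists>no. \<forall>n\<ge>no. norm (d ((\<sigma> \<circ> r) n) (\<sigma> n) - 0) < e"
      using N r d_nonneg cauchy_in[OF assms(1)]
      by (intro exI[of _ N]) (auto intro: order_trans)
  qed
  thus "ccls (\<sigma> \<circ> r) = ccls \<sigma>" using ccls_eq_iff[OF c assms(1)] by simp
qed

lemma short_map_cauchy:
  assumes "f ` X \<subseteq> Y" "\<And>x y. x \<in> X \<Longrightarrow> y \<in> X \<Longrightarrow> d' (f x) (f y) \<le> d x y" "\<sigma> \<in> cauchy"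
  shows "f \<circ> \<sigma> \<in> cauchy_seqs Y d'"
  unfolding cauchy_seqs_def
proof (intro CollectI conjI allI impI)
  show "range (f \<circ> \<sigma>) \<subseteq> Y" using cauchy_in[OF assms(3)] assms(1) by auto
  fix e :: real assume "0 < e"
  then obtain N where N: "\<And>n n'. N \<le> n \<Longrightarrow> N \<le> n' \<Longrightarrow> d (\<sigma> n) (\<sigma> n') < e"
    using cauchyD[OF assms(3)] by metis
  show "\<exists>N. \<forall>n n'. N \<le> n \<longrightarrow> N \<le> n' \<longrightarrow> d' ((f \<circ> \<sigma>) n) ((f \<circ> \<sigma>) n') < e"
  proof (intro exI[of _ N] allI impI)
    fix n n' assume "N \<le> n" "N \<le> n'"
    thus "d' ((f \<circ> \<sigma>) n) ((f \<circ> \<sigma>) n') < e"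
      using N[of n n'] assms(2)[of "\<sigma> n" "\<sigma> n'"] cauchy_in[OF assms(3)] by simp
  qed
qed

lemma C_map_eq:
  assumes f: "f ` X \<subseteq> X" "\<And>x y. x \<in> X \<Longrightarrow> y \<in> X \<Longrightarrow> d (f x) (f y) \<le> d x y" and s: "\<sigma> \<in> cauchy"
  shows "C_map X d f (ccls \<sigma>) = ccls (f \<circ> \<sigma>)"
proof -
  let ?s = "SOME \<tau>. \<tau> \<in> ccls \<sigma>"
  note s' = ccls_some[OF s]
  have c: "f \<circ> \<sigma> \<in> cauchy" "f \<circ> ?s \<in> cauchy"
    using short_map_cauchy[OF f] s s'(1) by auto
  have "(\<lambda>n. d ((f \<circ> \<sigma>) n) ((f \<circ> ?s) n)) \<longlonglongrightarrow> 0"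
    by (rule tendsto_sandwich[OF _ _ tendsto_const s'(2)])
      (use f(2) d_nonneg cauchy_in[OF c(1)] cauchy_in[OF c(2)] cauchy_in[OF s] cauchy_in[OF s'(1)] in auto)
  thus ?thesis using ccls_eq_iff[OF c] by (simp add: C_map_def)
qed

end

context squams_space
begin

interpretation completion: metric_set "C_carrier X d" "C_dist d"
  by unfold_locales (rule metric_completion)

lemma squams_completion: "squams cx cd (C_S X d S)"
proof -
  have SS: "C_S X d S p = emb (S p)" for p by (simp add: C_S_def)
  have dS: "cd (C_S X d S p) (C_S X d S q) = d (S p) (S q)" if "p \<in> M0" "q \<in> M0" for p q
    using that by (simp add: SS cd_emb)
  have inj: "inj_on (C_S X d S) M0"
  proof (rule inj_onI)
    fix p q assume pq: "p \<in> M0" "q \<in> M0" "C_S X d S p = C_S X d S q"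
    hence "d (S p) (S q) = 0"
      using dS[OF pq(1,2)] completion.d_self[of "C_S X d S q"] by (simp add: SS emb_in)
    thus "p = q" using pq S_inj by (simp add: d_eq_0_iff inj_on_def)
  qed
  have 2: "cd x y \<le> 2" if "x \<in> cx" "y \<in> cx" for x y
  proof -
    from that obtain \<sigma> \<tau> where "\<sigma> \<in> cauchy" "x = ccls \<sigma>" "\<tau> \<in> cauchy" "y = ccls \<tau>"
      by (metis cx_cases)
    thus ?thesis using cd_le[of \<sigma> \<tau> 0 2] d_le_2 cauchy_in by simp
  qed
  have Sin: "C_S X d S p \<in> cx" if "p \<in> M0" for p using that by (simp add: SS emb_in)
  show ?thesis
    unfolding squams_def
    using metric_completion 2 inj Sin
    by (auto simp: dS S_vertical S_horizontal M0_verticalI M0_horizontalI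
        intro!: taxi_le_d[unfolded taxi_def, simplified, of "(_, _)" "(_, _)", simplified])
qed

end

section \<open>Resampled boundary functions\<close>

lemma le_0_if_le_geometric:
  fixes t B c :: real
  assumes "0 \<le> c" "c < 1" "\<And>k. t \<le> B * c ^ k"
  shows "t \<le> 0"
proof -
  have "(\<lambda>k. B * c ^ k) \<longlonglongrightarrow> B * 0"
    by (intro tendsto_mult_left LIMSEQ_power_zero) (use assms in simp)
  thus ?thesis using LIMSEQ_le_const[of "\<lambda>k. B * c ^ k" 0 t] assms(3) by auto
qed

text \<open>The multiples of \<open>(1/3) ^ k\<close> in the unit interval. The recursion splits off
  the coarsest third first, matching the passage from an edge to the edges of the cells along
  it.\<close>

fun grid :: "nat \<Rightarrow> real set" where
  "grid 0 = {0, 1}"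
| "grid (Suc k) = {(real i + t) / 3 | i t. i < 3 \<and> t \<in> grid k}"

lemma grid_subset: "grid k \<subseteq> {0..1}"
proof (induction k)
  case (Suc k)
  have "(real i + t) / 3 \<in> {0..1}" if "i < 3" "t \<in> grid k" for i t
  proof -
    have "real i \<le> 2" using that(1) by linarith
    thus ?thesis using Suc that(2) by auto
  qed
  thus ?case unfolding grid.simps by blast
qed auto

lemma grid_SucI: "i < 3 \<Longrightarrow> t \<in> grid k \<Longrightarrow> (real i + t) / 3 \<in> grid (Suc k)"
  by auto

lemma abs_diff_thirds: "\<bar>(a + u) / 3 - (a + v) / 3\<bar> = \<bar>u - v\<bar> / 3" for a u v :: real
  by (auto simp: abs_if field_simps)

lemma grid_ends: "0 \<in> grid k" "1 \<in> grid k"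
proof (induction k)
  case (Suc k)
  show "0 \<in> grid (Suc k)" using grid_SucI[of 0 0 k] Suc by simp
  show "1 \<in> grid (Suc k)" using grid_SucI[of 2 1 k] Suc by simp
qed auto

lemma grid_near:
  assumes "s \<in> {0..1}"
  shows "\<exists>w\<in>grid k. \<bar>s - w\<bar> \<le> (1/3) ^ k"
  using assms
proof (induction k arbitrary: s)
  case 0
  thus ?case by (auto intro!: bexI[of _ 0])
next
  case (Suc k)
  obtain i t where i: "i < (3::nat)" "t \<in> {0..1}" "s = (real i + t) / 3"
    using Suc.prems by (rule unit_interval_thirds)
  obtain w where w: "w \<in> grid k" "\<bar>t - w\<bar> \<le> (1/3) ^ k" using Suc.IH[OF i(2)] by blast
  have "\<bar>s - (real i + w) / 3\<bar> = \<bar>t - w\<bar> / 3" unfolding i(3) by (rule abs_diff_thirds)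
  hence "\<bar>s - (real i + w) / 3\<bar> \<le> (1/3) ^ Suc k" using w by simp
  moreover have "(real i + w) / 3 \<in> grid (Suc k)" using i w by auto
  ultimately show ?case by blast
qed

section \<open>Lower Lipschitz extensions on the unit interval\<close>

definition lip01 :: "(real \<Rightarrow> real) \<Rightarrow> bool" where
  "lip01 \<phi> \<longleftrightarrow> (\<forall>s\<in>{0..1}. \<forall>t\<in>{0..1}. \<phi> s - \<phi> t \<le> \<bar>s - t\<bar>)"

lemma lip01D: "lip01 \<phi> \<Longrightarrow> s \<in> {0..1} \<Longrightarrow> t \<in> {0..1} \<Longrightarrow> \<phi> s - \<phi> t \<le> \<bar>s - t\<bar>"
  by (auto simp: lip01_def)

text \<open>The smallest 1-Lipschitz function that agrees with \<open>\<phi>\<close> on \<open>T\<close>.\<close>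

definition lower_ext :: "real set \<Rightarrow> (real \<Rightarrow> real) \<Rightarrow> real \<Rightarrow> real" where
  "lower_ext T \<phi> s = (SUP w\<in>T. \<phi> w - \<bar>s - w\<bar>)"

lemma lower_ext_le:
  assumes "lip01 \<phi>" "T \<subseteq> {0..1}" "0 \<in> T" "s \<in> {0..1}"
  shows "lower_ext T \<phi> s \<le> \<phi> s"
  unfolding lower_ext_def
proof (rule cSUP_least)
  fix w assume "w \<in> T"
  thus "\<phi> w - \<bar>s - w\<bar> \<le> \<phi> s"
    using lip01D[OF assms(1), of w s] assms by (auto simp: abs_minus_commute)
qed (use assms in auto)

lemma lower_ext_ge:
  assumes "lip01 \<phi>" "T \<subseteq> {0..1}" "s \<in> {0..1}" "w \<in> T"
  shows "\<phi> w - \<bar>s - w\<bar> \<le> lower_ext T \<phi> s"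
  unfolding lower_ext_def
proof (rule cSUP_upper[OF assms(4)], rule bdd_aboveI2[of _ _ "\<phi> s"])
  fix w assume "w \<in> T"
  thus "\<phi> w - \<bar>s - w\<bar> \<le> \<phi> s"
    using lip01D[OF assms(1), of w s] assms by (auto simp: abs_minus_commute)
qed

lemma lower_ext_eq:
  assumes "lip01 \<phi>" "T \<subseteq> {0..1}" "0 \<in> T" "s \<in> T"
  shows "lower_ext T \<phi> s = \<phi> s"
  using lower_ext_le[OF assms(1-3), of s] lower_ext_ge[OF assms(1,2) _ assms(4), of s] assms by auto

lemma lower_ext_cong:
  assumes "T \<subseteq> {0..1}" "\<And>t. t \<in> {0..1} \<Longrightarrow> \<phi> t = \<psi> t"
  shows "lower_ext T \<phi> s = lower_ext T \<psi> s"
  unfolding lower_ext_def using assms by (intro SUP_cong) auto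

text \<open>Both ends of a third are nodes of the finer grid. By the Lipschitz bound a node outside
  the third contributes no more than the end on its side, so only nodes inside matter, and these are
  a scaled copy of \<open>grid k\<close>.\<close>

lemma lower_ext_subdivision:
  assumes \<phi>: "lip01 \<phi>" and i: "i < 3" and t: "t \<in> {0..1}"
  shows "lower_ext (grid (Suc k)) \<phi> ((real i + t) / 3)
    = lower_ext (grid k) (\<lambda>t. 3 * \<phi> ((real i + t) / 3)) t / 3"
    (is "lower_ext ?T' \<phi> ?s = lower_ext ?T ?\<psi> t / 3")
proof (rule antisym)
  have unit: "(real j + u) / 3 \<in> {0..1}" if "j < 3" "u \<in> {0..1}" for j u
  proof -
    have "real j \<le> 2" using that by linarith
    thus ?thesis using that by auto
  qed
  have \<psi>: "lip01 ?\<psi>"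
    unfolding lip01_def
  proof (intro ballI)
    fix u v :: real assume "u \<in> {0..1}" "v \<in> {0..1}"
    moreover have "\<bar>(real i + u) / 3 - (real i + v) / 3\<bar> = \<bar>u - v\<bar> / 3" by (rule abs_diff_thirds)
    ultimately show "?\<psi> u - ?\<psi> v \<le> \<bar>u - v\<bar>"
      using lip01D[OF \<phi> unit[OF i, of u] unit[OF i, of v]] by simp
  qed
  have up: "(?\<psi> w - \<bar>t - w\<bar>) / 3 \<le> lower_ext ?T ?\<psi> t / 3" if "w \<in> ?T" for w
    using lower_ext_ge[OF \<psi> grid_subset t that] by simp
  show "lower_ext ?T' \<phi> ?s \<le> lower_ext ?T ?\<psi> t / 3"
    unfolding lower_ext_def[of ?T']
  proof (rule cSUP_least)
    show "?T' \<noteq> {}" using grid_ends(1)[of "Suc k"] by blast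
    fix v assume "v \<in> ?T'"
    then obtain j w where j: "j < 3" "w \<in> ?T" "v = (real j + w) / 3" by auto
    have w: "w \<in> {0..1}" using j grid_subset by blast
    have v: "v \<in> {0..1}" using unit[OF j(1) w] j by simp
    consider "j = i" | "j < i" | "i < j" by linarith
    thus "\<phi> v - \<bar>?s - v\<bar> \<le> lower_ext ?T ?\<psi> t / 3"
    proof cases
      case 1
      have v': "v = (real i + w) / 3" using 1 j by simp
      show ?thesis using up[OF j(2)] unfolding v' abs_diff_thirds by simp
    next
      case 2
      \<comment> \<open>The node \<open>v\<close> lies to the left of this third and is dominated by
        its left end, which is node 0 of \<open>grid k\<close>.\<close>
      hence ji: "real j + 1 \<le> real i" by linarith
      have "\<phi> v - \<phi> (real i / 3) \<le> \<bar>v - real i / 3\<bar>"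
        by (rule lip01D[OF \<phi> v]) (use i in auto)
      moreover have "v \<le> real i / 3" "real i / 3 \<le> ?s" using ji w t j by (auto simp: field_simps)
      moreover have "?s = real i / 3 + t / 3" by (simp add: field_simps)
      ultimately have "\<phi> v - \<bar>?s - v\<bar> \<le> \<phi> (real i / 3) - t / 3" by linarith
      thus ?thesis using up[OF grid_ends(1)] t by simp
    next
      case 3
      hence ji: "real i + 1 \<le> real j" by linarith
      have "\<phi> v - \<phi> ((real i + 1) / 3) \<le> \<bar>v - (real i + 1) / 3\<bar>"
        by (rule lip01D[OF \<phi> v unit[OF i]]) auto
      moreover have "(real i + 1) / 3 \<le> v" "?s \<le> (real i + 1) / 3" using ji w t j by (auto simp: field_simps)
      moreover have "?s = (real i + 1) / 3 - (1 - t) / 3" by (simp add: field_simps)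
      ultimately have "\<phi> v - \<bar>?s - v\<bar> \<le> \<phi> ((real i + 1) / 3) - (1 - t) / 3" by linarith
      thus ?thesis using up[OF grid_ends(2)] t by (simp add: field_simps)
    qed
  qed
  have "lower_ext ?T ?\<psi> t \<le> 3 * lower_ext ?T' \<phi> ?s"
    unfolding lower_ext_def[of ?T]
  proof (rule cSUP_least)
    show "?T \<noteq> {}" using grid_ends(1)[of k] by blast
    fix w assume w: "w \<in> ?T"
    have "\<phi> ((real i + w) / 3) - \<bar>?s - (real i + w) / 3\<bar> \<le> lower_ext ?T' \<phi> ?s"
      by (rule lower_ext_ge[OF \<phi> grid_subset unit[OF i t]]) (use i w in auto)
    moreover have "\<bar>?s - (real i + w) / 3\<bar> = \<bar>t - w\<bar> / 3" by (rule abs_diff_thirds)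
    ultimately show "?\<psi> w - \<bar>t - w\<bar> \<le> 3 * lower_ext ?T' \<phi> ?s" by simp
  qed
  thus "lower_ext ?T ?\<psi> t / 3 \<le> lower_ext ?T' \<phi> ?s" by simp
qed

section \<open>Resampling a Lipschitz function along the boundary\<close>

context squams_space
begin

definition lip :: "('a \<Rightarrow> real) \<Rightarrow> bool" where
  "lip D \<longleftrightarrow> (\<forall>x\<in>X. \<forall>y\<in>X. D x - D y \<le> d x y)"

lemma lipD: "lip D \<Longrightarrow> x \<in> X \<Longrightarrow> y \<in> X \<Longrightarrow> D x - D y \<le> d x y"
  by (auto simp: lip_def)

lemma lip_dist: "x \<in> X \<Longrightarrow> lip (d x)"
  unfolding lip_def using d_triangle d_commute by (smt (verit))

lemma lip_vertical: "lip D \<Longrightarrow> i \<in> {0,1} \<Longrightarrow> lip01 (\<lambda>t. D (S (i, t)))"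
  unfolding lip01_def
proof (intro ballI)
  fix s t :: real assume "lip D" "i \<in> {0,1}" "s \<in> {0..1}" "t \<in> {0..1}"
  thus "D (S (i, s)) - D (S (i, t)) \<le> \<bar>s - t\<bar>"
    using lipD[of D "S (i,s)" "S (i,t)"] S_vertical[of i s t] by (simp add: M0_verticalI abs_minus_commute)
qed

lemma lip_horizontal: "lip D \<Longrightarrow> i \<in> {0,1} \<Longrightarrow> lip01 (\<lambda>t. D (S (t, i)))"
  unfolding lip01_def
proof (intro ballI)
  fix s t :: real assume "lip D" "i \<in> {0,1}" "s \<in> {0..1}" "t \<in> {0..1}"
  thus "D (S (s, i)) - D (S (t, i)) \<le> \<bar>s - t\<bar>"
    using lipD[of D "S (s,i)" "S (t,i)"] S_horizontal[of i s t] by (simp add: M0_horizontalI abs_minus_commute)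
qed

text \<open>A corner belongs to two edges, and the vertical one is preferred here. Corners are nodes
  at every level, so for Lipschitz \<open>D\<close> both edges give the same value, as
  \<open>resample_horizontal\<close> confirms.\<close>

definition resample :: "nat \<Rightarrow> ('a \<Rightarrow> real) \<Rightarrow> real \<times> real \<Rightarrow> real" where
  "resample k D p = (if fst p \<in> {0,1} then lower_ext (grid k) (\<lambda>t. D (S (fst p, t))) (snd p)
     else lower_ext (grid k) (\<lambda>t. D (S (t, snd p))) (fst p))"

lemma resample_vertical:
  "i \<in> {0,1} \<Longrightarrow> resample k D (i, r) = lower_ext (grid k) (\<lambda>t. D (S (i, t))) r"
  by (simp add: resample_def)

lemma resample_horizontal:
  assumes "lip D" "i \<in> {0,1}"
  shows "resample k D (r, i) = lower_ext (grid k) (\<lambda>t. D (S (t, i))) r"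
proof (cases "r \<in> {0,1}")
  case True
  have "lower_ext (grid k) (\<lambda>t. D (S (r, t))) i = D (S (r, i))"
    using lower_ext_eq[OF lip_vertical[OF assms(1) True] grid_subset grid_ends(1), of i k] grid_ends assms(2)
    by auto
  moreover have "lower_ext (grid k) (\<lambda>t. D (S (t, i))) r = D (S (r, i))"
    using lower_ext_eq[OF lip_horizontal[OF assms] grid_subset grid_ends(1), of r k] grid_ends True
    by auto
  ultimately show ?thesis using True by (simp add: resample_vertical)
qed (simp add: resample_def)

lemma resample_le:
  assumes "lip D" "p \<in> M0"
  shows "resample k D p \<le> D (S p)"
  using assms(2)
proof (cases rule: M0_cases)
  case (vertical i r)
  thus ?thesis using lower_ext_le[OF lip_vertical[OF assms(1), of i] grid_subset grid_ends(1)]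
    by (simp add: resample_vertical)
next
  case (horizontal i r)
  thus ?thesis using lower_ext_le[OF lip_horizontal[OF assms(1), of i] grid_subset grid_ends(1)]
    by (simp add: resample_horizontal[OF assms(1)])
qed

text \<open>The nearest node is at most \<open>(1/3) ^ k\<close> away, and this gap counts twice:
  once for the change of \<open>D\<close>, once for the descent of the extension.\<close>

lemma resample_near:
  assumes "lip D" "p \<in> M0"
  shows "D (S p) - 2 * (1/3) ^ k \<le> resample k D p"
proof -
  have *: "\<phi> s - 2 * (1/3) ^ k \<le> lower_ext (grid k) \<phi> s" if \<phi>: "lip01 \<phi>" and s: "s \<in> {0..1}" for \<phi> s
  proof -
    obtain w where w: "w \<in> grid k" "\<bar>s - w\<bar> \<le> (1/3) ^ k" using grid_near[OF s] by blast
    have "w \<in> {0..1}" using w grid_subset by blast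
    thus ?thesis using lower_ext_ge[OF \<phi> grid_subset s w(1)] lip01D[OF \<phi> s, of w] w(2) by linarith
  qed
  from assms(2) show ?thesis
  proof (cases rule: M0_cases)
    case (vertical i r)
    thus ?thesis using *[OF lip_vertical[OF assms(1), of i], of r] by (simp add: resample_vertical)
  next
    case (horizontal i r)
    thus ?thesis using *[OF lip_horizontal[OF assms(1), of i], of r]
      by (simp add: resample_horizontal[OF assms(1)])
  qed
qed

text \<open>The path from \<open>w\<close> to \<open>p\<close> passes through a corner on the edge
  of \<open>p\<close>. That corner is a node, and \<open>D\<close> changes by at most the edge
  length on the way to it.\<close>

lemma resample_corner_le:
  assumes "lip D" "p \<in> M0" "w \<in> {0,1} \<times> {0,1}"
  shows "D (S w) - taxi p w \<le> resample k D p"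
proof -
  obtain u v where w: "w = (u, v)" "u \<in> {0,1}" "v \<in> {0,1}" using assms(3) by auto
  have g: "u \<in> grid k" "v \<in> grid k" using w grid_ends by auto
  from assms(2) show ?thesis
  proof (cases rule: M0_cases)
    case (vertical i r)
    have "D (S (u, v)) - D (S (i, v)) \<le> \<bar>u - i\<bar>"
      using lip01D[OF lip_horizontal[OF assms(1) w(3)], of u i] w vertical by auto
    moreover have "D (S (i, v)) - \<bar>r - v\<bar> \<le> resample k D p"
      using lower_ext_ge[OF lip_vertical[OF assms(1) vertical(2)] grid_subset vertical(3) g(2)] vertical
      by (simp add: resample_vertical)
    ultimately show ?thesis using vertical w by (auto simp: taxi_def abs_minus_commute)
  next
    case (horizontal i r)
    have "D (S (u, v)) - D (S (u, i)) \<le> \<bar>v - i\<bar>"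
      using lip01D[OF lip_vertical[OF assms(1) w(2)], of v i] w horizontal by auto
    moreover have "D (S (u, i)) - \<bar>r - u\<bar> \<le> resample k D p"
      using lower_ext_ge[OF lip_horizontal[OF assms(1) horizontal(2)] grid_subset horizontal(3) g(1)] horizontal
      by (simp add: resample_horizontal[OF assms(1)])
    ultimately show ?thesis using horizontal w by (auto simp: taxi_def abs_minus_commute)
  qed
qed

lemma resample_diff_le_2:
  assumes "lip D" "p \<in> M0" "p' \<in> M0"
  shows "resample k D p' - resample k D p \<le> 2"
proof -
  have *: "resample k D p' - resample k D p \<le> taxi p' w + taxi p w" if "w \<in> {0,1} \<times> {0,1}" for w
  proof -
    have "w \<in> M0" using that by (auto simp: M0_def)
    hence "D (S p') - D (S w) \<le> taxi p' w"
      using lipD[OF assms(1), of "S p'" "S w"] S_dist_corner[OF assms(3) that] assms(3) by simp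
    thus ?thesis
      using resample_le[OF assms(1,3), of k] resample_corner_le[OF assms(1,2) that, of k] by simp
  qed
  \<comment> \<open>The four bounds \<open>taxi p' w + taxi p w\<close>, one for each corner
    \<open>w\<close>, have average exactly 2, so one of them is at most 2.\<close>
  show ?thesis
    using *[of "(0,0)"] *[of "(0,1)"] *[of "(1,0)"] *[of "(1,1)"] M0_bounds[OF assms(2)] M0_bounds[OF assms(3)]
    by (simp add: taxi_def)
qed

lemma resample_0:
  assumes "lip D" "p \<in> M0"
  obtains w where "w \<in> {0,1} \<times> {0,1}" "resample 0 D p = D (S w) - taxi p w"
proof -
  have *: "\<exists>w\<in>{0,1}. lower_ext (grid 0) \<phi> s = \<phi> w - \<bar>s - w\<bar>" for \<phi> s
    by (auto simp: lower_ext_def cSup_eq_Max max_def)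
  from assms(2) show ?thesis
  proof (cases rule: M0_cases)
    case (vertical i r)
    obtain w where w: "w \<in> {0,1}" "lower_ext (grid 0) (\<lambda>t. D (S (i, t))) r = D (S (i, w)) - \<bar>r - w\<bar>"
      using *[of "\<lambda>t. D (S (i, t))" r] by blast
    hence "resample 0 D p = D (S (i, w)) - \<bar>r - w\<bar>" using vertical by (simp add: resample_vertical del: grid.simps)
    thus ?thesis by (intro that[of "(i, w)"]) (use w vertical in \<open>auto simp: taxi_def\<close>)
  next
    case (horizontal i r)
    obtain w where w: "w \<in> {0,1}" "lower_ext (grid 0) (\<lambda>t. D (S (t, i))) r = D (S (w, i)) - \<bar>r - w\<bar>"
      using *[of "\<lambda>t. D (S (t, i))" r] by blast
    hence "resample 0 D p = D (S (w, i)) - \<bar>r - w\<bar>" using horizontal by (simp add: resample_horizontal[OF assms(1)] del: grid.simps)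
    thus ?thesis by (intro that[of "(w, i)"]) (use w horizontal in \<open>auto simp: taxi_def\<close>)
  qed
qed

end

section \<open>Coalgebra morphisms into a self-similar space\<close>

text \<open>What finality requires of the target: completeness and the contractions for existence,
  \<open>gamma_Theta\<close> to turn fixed points into coalgebra morphisms, and
  \<open>Theta_gamma\<close> for the converse.\<close>

locale self_similar = Q: squams_space Q dQ SQ
  for Q :: "'q set" and dQ :: "'q \<Rightarrow> 'q \<Rightarrow> real" and SQ :: "real \<times> real \<Rightarrow> 'q" +
  fixes \<gamma> :: "'q \<Rightarrow> ((nat \<times> nat) \<times> 'q) set" and \<Theta> :: "nat \<times> nat \<Rightarrow> 'q \<Rightarrow> 'q"
  assumes complete: "s \<in> cauchy_seqs Q dQ \<Longrightarrow> \<exists>q\<in>Q. (\<lambda>k. dQ (s k) q) \<longlonglongrightarrow> 0"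
    and Theta_in: "m \<in> Mset \<Longrightarrow> q \<in> Q \<Longrightarrow> \<Theta> m q \<in> Q"
    and Theta_contract: "m \<in> Mset \<Longrightarrow> q \<in> Q \<Longrightarrow> q' \<in> Q \<Longrightarrow> dQ (\<Theta> m q) (\<Theta> m q') \<le> dQ q q' / 3"
    and Theta_S: "m \<in> Mset \<Longrightarrow> p \<in> M0 \<Longrightarrow> r \<in> M0 \<Longrightarrow>
      shift m r = (3 * fst p, 3 * snd p) \<Longrightarrow> \<Theta> m (SQ r) = SQ p"
    and Theta_glue: "m \<in> Mset \<Longrightarrow> n \<in> Mset \<Longrightarrow> p \<in> M0 \<Longrightarrow> r \<in> M0 \<Longrightarrow>
      shift m p = shift n r \<Longrightarrow> \<Theta> m (SQ p) = \<Theta> n (SQ r)"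
    and gamma_Theta: "m \<in> Mset \<Longrightarrow> q \<in> Q \<Longrightarrow> \<gamma> (\<Theta> m q) = ten_class Q SQ (m, q)"
    and Theta_gamma: "m \<in> Mset \<Longrightarrow> q \<in> Q \<Longrightarrow> q' \<in> Q \<Longrightarrow> \<gamma> q = ten_class Q SQ (m, q') \<Longrightarrow> \<Theta> m q' = q"

locale coalgebra_into = self_similar Q dQ SQ \<gamma> \<Theta> + A: squams_space A dA SA
  for Q :: "'q set" and dQ SQ \<gamma> \<Theta>
    and A :: "'c set" and dA :: "'c \<Rightarrow> 'c \<Rightarrow> real" and SA :: "real \<times> real \<Rightarrow> 'c" +
  fixes \<alpha> :: "'c \<Rightarrow> ((nat \<times> nat) \<times> 'c) set"
  assumes coalgebra: "sq_morph A dA SA (ten_carrier A SA) (ten_dist A dA SA) (ten_S A SA) \<alpha>"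
begin

lemma alpha_in: "x \<in> A \<Longrightarrow> \<alpha> x \<in> ten_carrier A SA"
  using coalgebra by (auto simp: sq_morph_def)

lemma alpha_short: "x \<in> A \<Longrightarrow> y \<in> A \<Longrightarrow> A.td (\<alpha> x) (\<alpha> y) \<le> dA x y"
  using coalgebra by (auto simp: sq_morph_def)

lemma alpha_S: "p \<in> M0 \<Longrightarrow> \<alpha> (SA p) = ten_S A SA p"
  using coalgebra by (auto simp: sq_morph_def)

text \<open>The representative chosen here is the one in the definition of \<open>ten_map\<close>.\<close>

definition rep :: "'c \<Rightarrow> (nat \<times> nat) \<times> 'c" where
  "rep x = (SOME r. r \<in> \<alpha> x)"

lemma rep_in: "x \<in> A \<Longrightarrow> fst (rep x) \<in> Mset" "x \<in> A \<Longrightarrow> snd (rep x) \<in> A"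
  using ten_carrier_someI(1)[OF alpha_in, of x] unfolding rep_def by (auto simp: mem_Times_iff)

lemma cls_rep: "x \<in> A \<Longrightarrow> A.cls (rep x) = \<alpha> x"
  using ten_carrier_someI(2)[OF alpha_in] by (simp add: rep_def)

text \<open>The chosen representative of a boundary point is again a boundary point at the same
  position, by \<open>ten_rel_boundary\<close>.\<close>

lemma rep_boundary:
  assumes "p \<in> M0"
  obtains n q where "rep (SA p) = (n, SA q)" "n \<in> Mset" "q \<in> M0" "shift n q = (3 * fst p, 3 * snd p)"
proof -
  obtain m r where m: "m \<in> Mset" "r \<in> M0" "shift m r = (3 * fst p, 3 * snd p)"
    using assms by (rule M0_cell)
  have a: "SA p \<in> A" using assms by simp
  have R: "rep (SA p) \<in> Mset \<times> A" using rep_in[OF a] by (simp add: mem_Times_iff)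
  have "A.cls (m, SA r) = A.cls (rep (SA p))"
    using A.ten_S_eq[OF assms m] alpha_S[OF assms] cls_rep[OF a] by simp
  hence "((m, SA r), rep (SA p)) \<in> ten_rel A SA"
    using m R by (subst (asm) ten_class_eq_iff) auto
  then obtain n q where "rep (SA p) = (n, SA q)" "q \<in> M0" "shift n q = shift m r"
    using A.S_inj m(2) by (rule ten_rel_boundary)
  thus ?thesis using that R m by auto
qed

text \<open>The factor 3 cancels the contraction, so an induction hypothesis quantified over all
  Lipschitz \<open>D\<close> applies in every cell.\<close>

lemma lip_scaled:
  assumes "Q.lip D" "m \<in> Mset"
  shows "Q.lip (\<lambda>y. 3 * D (\<Theta> m y))"
  unfolding Q.lip_def
proof (intro ballI)
  fix x y assume "x \<in> Q" "y \<in> Q"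
  thus "3 * D (\<Theta> m x) - 3 * D (\<Theta> m y) \<le> dQ x y"
    using Q.lipD[OF assms(1), of "\<Theta> m x" "\<Theta> m y"] Theta_contract[OF assms(2), of x y] Theta_in[OF assms(2)]
    by force
qed

section \<open>Resampling across neighbouring cells and under subdivision\<close>

lemma resample_glue_vertical:
  assumes "m \<in> Mset" "n \<in> Mset" "fst n = fst m + 1" "snd n = snd m"
  shows "Q.resample k (\<lambda>y. 3 * D (\<Theta> m y)) (1, s) = Q.resample k (\<lambda>y. 3 * D (\<Theta> n y)) (0, s)"
proof -
  have "\<Theta> m (SQ (1, t)) = \<Theta> n (SQ (0, t))" if "t \<in> {0..1}" for t
    by (rule Theta_glue) (use assms that in \<open>auto simp: M0_def shift_def\<close>)
  thus ?thesis
    by (simp add: Q.resample_vertical) (rule lower_ext_cong[OF grid_subset], simp)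
qed

lemma resample_glue_horizontal:
  assumes "Q.lip D" "m \<in> Mset" "n \<in> Mset" "snd n = snd m + 1" "fst n = fst m"
  shows "Q.resample k (\<lambda>y. 3 * D (\<Theta> m y)) (s, 1) = Q.resample k (\<lambda>y. 3 * D (\<Theta> n y)) (s, 0)"
proof -
  have "\<Theta> m (SQ (t, 1)) = \<Theta> n (SQ (t, 0))" if "t \<in> {0..1}" for t
    by (rule Theta_glue) (use assms that in \<open>auto simp: M0_def shift_def\<close>)
  thus ?thesis
    using Q.resample_horizontal[OF lip_scaled[OF assms(1,2)], of 1 k s]
      Q.resample_horizontal[OF lip_scaled[OF assms(1,3)], of 0 k s]
    by simp (rule lower_ext_cong[OF grid_subset], simp)
qed

text \<open>Neighbouring cells induce the same function on their common edge, and resampling an edge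
  depends on nothing else.\<close>

lemma resample_glue:
  assumes D: "Q.lip D" and mn: "m \<in> Mset" "n \<in> Mset" and pq: "p \<in> M0" "q \<in> M0"
    and adj: "adjacent m n" and eq: "shift m p = shift n q"
  shows "Q.resample k (\<lambda>y. 3 * D (\<Theta> m y)) p = Q.resample k (\<lambda>y. 3 * D (\<Theta> n y)) q"
proof -
  have e: "real (fst m) + fst p = real (fst n) + fst q" "real (snd m) + snd p = real (snd n) + snd q"
    using eq by (auto simp: shift_def)
  note b = M0_bounds[OF pq(1)] M0_bounds[OF pq(2)]
  consider "fst n = fst m + 1" "snd n = snd m" | "fst m = fst n + 1" "snd n = snd m"
    | "snd n = snd m + 1" "fst n = fst m" | "snd m = snd n + 1" "fst n = fst m"
    using adj by (auto simp: adjacent_def)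
  thus ?thesis
  proof cases
    case 1
    obtain s where "p = (1, s)" "q = (0, s)" using 1 e b by (cases p, cases q) auto
    thus ?thesis using resample_glue_vertical[OF mn 1, of k D s] by simp
  next
    case 2
    obtain s where "q = (1, s)" "p = (0, s)" using 2 e b by (cases p, cases q) auto
    thus ?thesis using resample_glue_vertical[OF mn(2,1) 2(1) 2(2)[symmetric], of k D s] by simp
  next
    case 3
    obtain s where "p = (s, 1)" "q = (s, 0)" using 3 e b by (cases p, cases q) auto
    thus ?thesis using resample_glue_horizontal[OF D mn 3, of k s] by simp
  next
    case 4
    obtain s where "q = (s, 1)" "p = (s, 0)" using 4 e b by (cases p, cases q) auto
    thus ?thesis using resample_glue_horizontal[OF D mn(2,1) 4(1) 4(2)[symmetric], of k s] by simp
  qed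
qed

text \<open>\<open>Theta_S\<close> identifies an edge of the cell with a third of an edge of the
  square; the rest is \<open>lower_ext_subdivision\<close>.\<close>

lemma resample_Suc:
  assumes D: "Q.lip D" and p: "p \<in> M0" and m: "m \<in> Mset" and q: "q \<in> M0"
    and eq: "shift m q = (3 * fst p, 3 * snd p)"
  shows "Q.resample (Suc k) D p = Q.resample k (\<lambda>y. 3 * D (\<Theta> m y)) q / 3"
proof -
  have e: "real (fst m) + fst q = 3 * fst p" "real (snd m) + snd q = 3 * snd p"
    using eq by (auto simp: shift_def)
  have m3: "fst m < 3" "snd m < 3" using m by (auto simp: Mset_def)
  note b = M0_bounds[OF q]
  \<comment> \<open>Where \<open>p\<close> has coordinate 0 or 1, the cell is the first or the last
    one and \<open>q\<close> has the same coordinate.\<close>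
  have end_cell: "u = i" if "i \<in> {0,1}" "real j + u = 3 * i" "j < 3" "0 \<le> u" "u \<le> 1" for i u :: real and j
    using that by auto
  from p show ?thesis
  proof (cases rule: M0_cases)
    case (vertical i r)
    have fq: "fst q = i" using end_cell[of i "fst m" "fst q"] vertical e b m3 by auto
    hence q': "q = (i, snd q)" by (simp add: prod_eq_iff)
    have r: "r = (real (snd m) + snd q) / 3" using e vertical by simp
    have "Q.resample (Suc k) D p
        = lower_ext (grid k) (\<lambda>t. 3 * D (SQ (i, (real (snd m) + t) / 3))) (snd q) / 3"
      unfolding vertical(1) Q.resample_vertical[OF vertical(2)] r
      by (rule lower_ext_subdivision[OF Q.lip_vertical[OF D vertical(2)] m3(2)]) (use b in auto)
    also have "\<dots> = lower_ext (grid k) (\<lambda>t. 3 * D (\<Theta> m (SQ (i, t)))) (snd q) / 3"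
    proof -
      have "\<Theta> m (SQ (i, t)) = SQ (i, (real (snd m) + t) / 3)" if "t \<in> {0..1}" for t
        by (rule Theta_S[OF m]) (use vertical fq e m3 that in \<open>auto simp: M0_def shift_def\<close>)
      thus ?thesis
        by (intro arg_cong2[of _ _ _ _ "(/)"] refl lower_ext_cong[OF grid_subset]) simp
    qed
    finally show ?thesis
      by (subst q') (simp add: Q.resample_vertical[OF vertical(2)])
  next
    case (horizontal i r)
    have sq: "snd q = i" using end_cell[of i "snd m" "snd q"] horizontal e b m3 by auto
    hence q': "q = (fst q, i)" by (simp add: prod_eq_iff)
    have r: "r = (real (fst m) + fst q) / 3" using e horizontal by simp
    have "Q.resample (Suc k) D p
        = lower_ext (grid k) (\<lambda>t. 3 * D (SQ ((real (fst m) + t) / 3, i))) (fst q) / 3"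
      unfolding horizontal(1) Q.resample_horizontal[OF D horizontal(2)] r
      by (rule lower_ext_subdivision[OF Q.lip_horizontal[OF D horizontal(2)] m3(1)]) (use b in auto)
    also have "\<dots> = lower_ext (grid k) (\<lambda>t. 3 * D (\<Theta> m (SQ (t, i)))) (fst q) / 3"
    proof -
      have "\<Theta> m (SQ (t, i)) = SQ ((real (fst m) + t) / 3, i)" if "t \<in> {0..1}" for t
        by (rule Theta_S[OF m]) (use horizontal sq e m3 that in \<open>auto simp: M0_def shift_def\<close>)
      thus ?thesis
        by (intro arg_cong2[of _ _ _ _ "(/)"] refl lower_ext_cong[OF grid_subset]) simp
    qed
    finally show ?thesis
      by (subst q') (simp add: Q.resample_horizontal[OF lip_scaled[OF D m] horizontal(2)])
  qed
qed

text \<open>The induction step extends the resampled boundary functions of the eight cells to \<open>A\<close>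
  and glues them to a function on \<open>M \<otimes> A\<close>; pulling it back along \<open>\<alpha>\<close> gives the next level.
  A direct induction on \<open>D \<circ> SQ\<close> would accumulate one error term per cell crossed; resampling
  makes the start of the induction exact.\<close>

lemma resample_short:
  assumes "Q.lip D" "p \<in> M0" "p' \<in> M0"
  shows "Q.resample k D p' - Q.resample k D p \<le> dA (SA p) (SA p')"
  using assms
proof (induction k arbitrary: D p p')
  case 0
  obtain w where w: "w \<in> {0,1} \<times> {0,1}" "Q.resample 0 D p' = D (SQ w) - taxi p' w"
    using 0(1,3) by (rule Q.resample_0)
  \<comment> \<open>The corner attaining the value at \<open>p'\<close> also bounds the value at
    \<open>p\<close>; \<open>D (SQ w)\<close> cancels and only taxicab distances remain.\<close>
  have "D (SQ w) - taxi p w \<le> Q.resample 0 D p" using Q.resample_corner_le[OF 0(1,2) w(1)] .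
  thus ?case
    using w taxi_triangle[of p w p'] A.taxi_le_d[OF 0(2,3)] by simp
next
  case (Suc k)
  define c where "c m = Q.resample k (\<lambda>y. 3 * D (\<Theta> m y))" for m
  have c_lip: "c m p' - c m p \<le> dA (SA p) (SA p')" if "m \<in> Mset" "p \<in> M0" "p' \<in> M0" for m p p'
    unfolding c_def by (rule Suc.IH[OF lip_scaled[OF Suc.prems(1)]]) (use that in auto)
  have c_below: "c m (0,0) - 2 \<le> c m p" if "m \<in> Mset" "p \<in> M0" for m p
    using c_lip[OF that(1,2), of "(0,0)"] A.d_le_2[of "SA p" "SA (0,0)"] that by simp
  \<comment> \<open>\<open>c_lip\<close>, which is the induction hypothesis, is exactly the
    condition under which this extension keeps the values \<open>c\<close> on the cell
    boundary.\<close>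
  define g where "g z = A.mcshane M0 (c (fst z)) SA (snd z) / 3" for z
  have g_S: "g (m, SA p) = c m p / 3" if "m \<in> Mset" "p \<in> M0" for m p
    unfolding g_def using A.mcshane_extends[of M0 SA "c m (0,0) - 2" "c m" p] that c_below c_lip by simp
  obtain m q where m: "m \<in> Mset" "q \<in> M0" "shift m q = (3 * fst p, 3 * snd p)"
    using Suc.prems(2) by (rule M0_cell)
  obtain m' q' where m': "m' \<in> Mset" "q' \<in> M0" "shift m' q' = (3 * fst p', 3 * snd p')"
    using Suc.prems(3) by (rule M0_cell)
  have "min 2 (g (m', SA q') - g (m, SA q)) \<le> A.td (A.cls (m, SA q)) (A.cls (m', SA q'))"
  proof (rule A.td_lower)
    show "compatible SA g"
      unfolding compatible_def
    proof (intro ballI impI)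
      fix m n p q assume a: "m \<in> Mset" "n \<in> Mset" "p \<in> M0" "q \<in> M0" "adjacent m n" "shift m p = shift n q"
      show "g (m, SA p) = g (n, SA q)"
        using resample_glue[OF Suc.prems(1) a] a by (simp add: g_S c_def)
    qed
    fix n x y assume n: "n \<in> Mset" "x \<in> A" "y \<in> A"
    show "g (n, y) - g (n, x) \<le> dA x y / 3"
      using A.mcshane_lipschitz[of M0 SA "c n (0,0) - 2" "c n" x y] n c_below M0_corner
      by (auto simp: g_def simp del: M0_corner)
  qed (use m m' in auto)
  also have "\<dots> \<le> dA (SA p) (SA p')"
    using alpha_short[of "SA p" "SA p'"] Suc.prems
    by (simp add: alpha_S A.ten_S_eq[OF Suc.prems(2) m] A.ten_S_eq[OF Suc.prems(3) m'])
  \<comment> \<open>The minimum with 2 stems from jumps between cells in \<open>td_lower\<close>;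
    \<open>resample_diff_le_2\<close> removes it.\<close>
  finally have "min 2 (Q.resample (Suc k) D p' - Q.resample (Suc k) D p) \<le> dA (SA p) (SA p')"
    using m m' by (simp add: g_S resample_Suc[OF Suc.prems(1,2) m] resample_Suc[OF Suc.prems(1,3) m'] c_def)
  thus ?case using Q.resample_diff_le_2[OF Suc.prems, of "Suc k"] by simp
qed

text \<open>Taken with \<open>D\<close> the distance from \<open>SQ p\<close>: resampling keeps the
  value at most 0 at \<open>p\<close> and loses at most \<open>2 * (1/3) ^ k\<close> at
  \<open>p'\<close>.\<close>

lemma boundary_short:
  assumes "p \<in> M0" "p' \<in> M0"
  shows "dQ (SQ p) (SQ p') \<le> dA (SA p) (SA p')"
proof -
  have D: "Q.lip (dQ (SQ p))" using Q.lip_dist assms by simp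
  have "dQ (SQ p) (SQ p') - dA (SA p) (SA p') \<le> 2 * (1/3) ^ k" for k
    using resample_short[OF D assms, of k] Q.resample_near[OF D assms(2), of k]
      Q.resample_le[OF D assms(1), of k] assms by simp
  from le_0_if_le_geometric[OF _ _ this] show ?thesis by simp
qed

text \<open>Boundary points are mapped without error by \<open>boundary_short\<close>, so the error
  \<open>e\<close>, scaled by 1/3, is paid only on the first and on the last segment. The proof
  expresses this through a potential rather than through chains.\<close>

lemma fixed_point_short_step:
  assumes h: "\<And>x. x \<in> A \<Longrightarrow> h x \<in> Q" "\<And>x. x \<in> A \<Longrightarrow> h x = \<Theta> (fst (rep x)) (h (snd (rep x)))"
    and hS: "\<And>p. p \<in> M0 \<Longrightarrow> h (SA p) = SQ p"
    and e: "\<And>x y. x \<in> A \<Longrightarrow> y \<in> A \<Longrightarrow> dQ (h x) (h y) \<le> dA x y + e" "0 \<le> e"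
    and xy: "x \<in> A" "y \<in> A"
  shows "dQ (h x) (h y) \<le> dA x y + 2 / 3 * e"
proof -
  obtain m a where a: "rep x = (m, a)" "m \<in> Mset" "a \<in> A" "h x = \<Theta> m (h a)"
    using rep_in[OF xy(1)] h(2)[OF xy(1)] by (cases "rep x") auto
  obtain n b where b: "rep y = (n, b)" "n \<in> Mset" "b \<in> A" "h y = \<Theta> n (h b)"
    using rep_in[OF xy(2)] h(2)[OF xy(2)] by (cases "rep y") auto
  define K where "K l p = dQ (h x) (\<Theta> l (SQ p))" for l p
  have K_nonneg: "0 \<le> 3 * K l p" if "l \<in> Mset" "p \<in> M0" for l p
    using that xy h(1) by (simp add: K_def Q.d_nonneg Theta_in)
  have K_lip: "3 * K l p - 3 * K l p' \<le> dA (SA p') (SA p)" if "l \<in> Mset" "p \<in> M0" "p' \<in> M0" for l p p'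
  proof -
    have "K l p \<le> K l p' + dQ (\<Theta> l (SQ p')) (\<Theta> l (SQ p))"
      unfolding K_def by (rule Q.d_triangle) (use that xy h(1) in \<open>auto intro: Theta_in\<close>)
    thus ?thesis
      using Theta_contract[of l "SQ p'" "SQ p"] boundary_short[of p' p] that by simp
  qed
  \<comment> \<open>The extension of \<open>K\<close> from the cell boundaries, lowered by the error
    \<open>e / 3\<close> of the first segment.\<close>
  define F where "F l c = A.mcshane M0 (\<lambda>p. 3 * K l p) SA c / 3 - e / 3" for l c
  have F_S: "F l (SA p) = K l p - e / 3" if "l \<in> Mset" "p \<in> M0" for l p
    unfolding F_def
    using A.mcshane_extends[of M0 SA 0 "\<lambda>p. 3 * K l p" p] that K_nonneg K_lip by simp
  have F_lip: "F l v - F l u \<le> dA u v / 3" if "l \<in> Mset" "u \<in> A" "v \<in> A" for l u v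
    using A.mcshane_lipschitz[of M0 SA 0 "\<lambda>p. 3 * K l p" u v] that K_nonneg M0_corner
    by (auto simp: F_def simp del: M0_corner)
  have F_ge: "dQ (h x) (h y) - 2 / 3 * e \<le> F n b"
  proof -
    have "3 * dQ (h x) (h y) - e \<le> A.mcshane M0 (\<lambda>p. 3 * K n p) SA b"
    proof (rule A.mcshane_ge)
      fix p assume p: "p \<in> M0"
      have "dQ (h x) (h y) \<le> K n p + dQ (\<Theta> n (SQ p)) (\<Theta> n (h b))"
        unfolding K_def b(4) by (rule Q.d_triangle) (use p b xy h(1) in \<open>auto intro: Theta_in\<close>)
      moreover have "3 * dQ (\<Theta> n (SQ p)) (\<Theta> n (h b)) \<le> dA (SA p) b + e"
        using Theta_contract[of n "SQ p" "h b"] e(1)[of "SA p" b] p b h(1) by (simp add: hS)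
      ultimately show "3 * dQ (h x) (h y) - e \<le> 3 * K n p + dA (SA p) b" by simp
    qed (use M0_corner in blast)
    thus ?thesis by (simp add: F_def)
  qed
  \<comment> \<open>In the starting cell the direct route from \<open>a\<close> competes. On the
    boundary it never wins, because of the subtracted \<open>e / 3\<close>, so \<open>g\<close>
    glues.\<close>
  define g where "g z = (if fst z = m then min (dA a (snd z) / 3) (F m (snd z)) else F (fst z) (snd z))" for z
  have g_S: "g (l, SA p) = K l p - e / 3" if "l \<in> Mset" "p \<in> M0" for l p
  proof -
    have "K m p - e / 3 \<le> dA a (SA p) / 3"
      using Theta_contract[of m "h a" "SQ p"] e(1)[of a "SA p"] that a h(1) by (simp add: K_def hS)
    thus ?thesis using that a by (auto simp: g_def F_S)
  qed
  have "min 2 (g (n, b) - g (m, a)) \<le> A.td (A.cls (m, a)) (A.cls (n, b))"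
  proof (rule A.td_lower)
    show "compatible SA g"
      unfolding compatible_def by (auto simp: g_S K_def intro!: arg_cong[OF Theta_glue])
    fix l u v assume l: "l \<in> Mset" "u \<in> A" "v \<in> A"
    have "dA a v \<le> dA a u + dA u v" using A.d_triangle[of a u v] a l by simp
    thus "g (l, v) - g (l, u) \<le> dA u v / 3"
      using F_lip[OF l] by (auto simp: g_def min_def)
  qed (use a b in auto)
  also have "\<dots> \<le> dA x y"
    using alpha_short[OF xy] cls_rep[OF xy(1)] cls_rep[OF xy(2)] a b by simp
  finally have main: "min 2 (g (n, b) - g (m, a)) \<le> dA x y" .
  have "g (m, a) \<le> 0" using a by (simp add: g_def min_def)
  moreover have "dQ (h x) (h y) - 2 / 3 * e \<le> g (n, b)"
  proof (cases "n = m")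
    case True
    \<comment> \<open>With both points in one cell the direct route must satisfy the bound too;
      contraction gives this with error only \<open>e / 3\<close>.\<close>
    have "dQ (h x) (h y) \<le> dQ (h a) (h b) / 3"
      unfolding a(4) b(4) True using a b h(1) by (intro Theta_contract) auto
    hence "dQ (h x) (h y) - 2 / 3 * e \<le> dA a b / 3" using e(1)[of a b] e(2) a b by simp
    thus ?thesis using F_ge True by (simp add: g_def)
  next
    case False thus ?thesis using F_ge by (simp add: g_def)
  qed
  moreover have "dQ (h x) (h y) \<le> 2" using Q.d_le_2 h(1) xy by simp
  ultimately show ?thesis using main e(2) by (auto simp: min_def split: if_splits)
qed

lemma fixed_point_short:
  assumes h: "\<And>x. x \<in> A \<Longrightarrow> h x \<in> Q" "\<And>x. x \<in> A \<Longrightarrow> h x = \<Theta> (fst (rep x)) (h (snd (rep x)))"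
    and hS: "\<And>p. p \<in> M0 \<Longrightarrow> h (SA p) = SQ p"
    and xy: "x \<in> A" "y \<in> A"
  shows "dQ (h x) (h y) \<le> dA x y"
proof -
  have "\<forall>x\<in>A. \<forall>y\<in>A. dQ (h x) (h y) \<le> dA x y + 2 * (2/3) ^ k" for k
  proof (induction k)
    case 0
    show ?case
    proof (intro ballI)
      fix x y assume "x \<in> A" "y \<in> A"
      thus "dQ (h x) (h y) \<le> dA x y + 2 * (2/3) ^ 0"
        using Q.d_le_2[of "h x" "h y"] A.d_nonneg[of x y] h(1) by simp
    qed
  next
    case (Suc k)
    show ?case
    proof (intro ballI)
      fix x y assume "x \<in> A" "y \<in> A"
      from fixed_point_short_step[OF h hS _ _ this, of "2 * (2/3) ^ k"] Suc
      show "dQ (h x) (h y) \<le> dA x y + 2 * (2/3) ^ Suc k" by simp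
    qed
  qed
  hence "dQ (h x) (h y) - dA x y \<le> 2 * (2/3) ^ k" for k using xy by (auto simp: algebra_simps)
  from le_0_if_le_geometric[OF _ _ this] show ?thesis by simp
qed

text \<open>Picard iterates of the contraction sending \<open>h\<close> to
  \<open>\<Theta> (fst (rep x)) (h (snd (rep x)))\<close>, started at a constant map.\<close>

fun approx :: "nat \<Rightarrow> 'c \<Rightarrow> 'q" where
  "approx 0 x = SQ (0, 0)"
| "approx (Suc k) x = \<Theta> (fst (rep x)) (approx k (snd (rep x)))"

lemma approx_in: "x \<in> A \<Longrightarrow> approx k x \<in> Q"
  by (induction k arbitrary: x) (auto intro!: Theta_in rep_in)

lemma approx_dist: "x \<in> A \<Longrightarrow> dQ (approx (k + j) x) (approx k x) \<le> 2 * (1/3) ^ k"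
proof (induction k arbitrary: x)
  case 0
  thus ?case using Q.d_le_2[of "approx j x" "SQ (0,0)"] approx_in by simp
next
  case (Suc k)
  have "dQ (approx (Suc k + j) x) (approx (Suc k) x)
      \<le> dQ (approx (k + j) (snd (rep x))) (approx k (snd (rep x))) / 3"
    unfolding add_Suc approx.simps using Suc.prems by (intro Theta_contract approx_in rep_in)
  thus ?case using Suc.IH[of "snd (rep x)"] Suc.prems rep_in by simp
qed

lemma approx_cauchy:
  assumes "x \<in> A" shows "(\<lambda>k. approx k x) \<in> cauchy_seqs Q dQ"
  unfolding cauchy_seqs_def
proof (intro CollectI conjI allI impI)
  show "range (\<lambda>k. approx k x) \<subseteq> Q" using approx_in assms by auto
  fix e :: real assume e: "0 < e"
  obtain N where N: "(1/3) ^ N < e / 4" using real_arch_pow_inv[of "e/4" "1/3"] e by auto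
  have *: "dQ (approx n x) (approx N x) < e / 2" if "N \<le> n" for n
    using approx_dist[OF assms, of N "n - N"] N that by simp
  show "\<exists>N. \<forall>n n'. N \<le> n \<longrightarrow> N \<le> n' \<longrightarrow> dQ (approx n x) (approx n' x) < e"
  proof (intro exI[of _ N] allI impI)
    fix n n' assume "N \<le> n" "N \<le> n'"
    thus "dQ (approx n x) (approx n' x) < e"
      using *[of n] *[of n'] Q.d_triangle[of "approx n x" "approx N x" "approx n' x"]
        Q.d_commute[of "approx n' x" "approx N x"] approx_in[OF assms] by simp
  qed
qed

lemma fixed_point_exists:
  "\<exists>h. (\<forall>x\<in>A. h x \<in> Q \<and> h x = \<Theta> (fst (rep x)) (h (snd (rep x)))) \<and> (\<forall>p\<in>M0. h (SA p) = SQ p)"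
proof -
  have "\<forall>x\<in>A. \<exists>q\<in>Q. (\<lambda>k. dQ (approx k x) q) \<longlonglongrightarrow> 0"
    using complete approx_cauchy by blast
  then obtain h where h: "\<And>x. x \<in> A \<Longrightarrow> h x \<in> Q" "\<And>x. x \<in> A \<Longrightarrow> (\<lambda>k. dQ (approx k x) (h x)) \<longlonglongrightarrow> 0"
    by metis
  have fixed: "h x = \<Theta> (fst (rep x)) (h (snd (rep x)))" if x: "x \<in> A" for x
  proof -
    let ?m = "fst (rep x)" and ?y = "snd (rep x)"
    note r = rep_in[OF x]
    have T: "\<Theta> ?m (h ?y) \<in> Q" using Theta_in r h(1) by simp
    have l: "(\<lambda>k. dQ (approx (Suc k) x) (h x) + dQ (approx k ?y) (h ?y) / 3) \<longlonglongrightarrow> 0 + 0 / 3"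
      by (intro tendsto_intros h(2) r x LIMSEQ_Suc[of "\<lambda>k. dQ (approx k x) (h x)"])  simp
    have "dQ (h x) (\<Theta> ?m (h ?y)) \<le> dQ (approx (Suc k) x) (h x) + dQ (approx k ?y) (h ?y) / 3" for k
    proof -
      have "dQ (h x) (\<Theta> ?m (h ?y)) \<le> dQ (h x) (approx (Suc k) x) + dQ (approx (Suc k) x) (\<Theta> ?m (h ?y))"
        by (rule Q.d_triangle) (use h(1) x T approx_in in blast)+
      moreover have "dQ (approx (Suc k) x) (\<Theta> ?m (h ?y)) \<le> dQ (approx k ?y) (h ?y) / 3"
        unfolding approx.simps by (rule Theta_contract) (use r h(1) approx_in in auto)
      moreover have "dQ (h x) (approx (Suc k) x) = dQ (approx (Suc k) x) (h x)"
        by (rule Q.d_commute) (use h(1) x approx_in in blast)+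
      ultimately show ?thesis by linarith
    qed
    hence "dQ (h x) (\<Theta> ?m (h ?y)) \<le> 0" using LIMSEQ_le_const[OF l] by auto
    thus ?thesis using Q.d_nonneg[OF h(1)[OF x] T] Q.d_eq_0_iff[OF h(1)[OF x] T] by simp
  qed
  \<comment> \<open>\<open>SQ\<close> satisfies the same recursion along representatives of boundary
    points, so its distance to \<open>h\<close> on the boundary shrinks by 1/3 in each
    round.\<close>
  have "\<forall>p\<in>M0. dQ (h (SA p)) (SQ p) \<le> 2 * (1/3) ^ k" for k
  proof (induction k)
    case 0
    thus ?case using Q.d_le_2 h(1) by simp
  next
    case (Suc k)
    show ?case
    proof
      fix p assume p: "p \<in> M0"
      obtain n q where n: "rep (SA p) = (n, SA q)" "n \<in> Mset" "q \<in> M0" "shift n q = (3 * fst p, 3 * snd p)"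
        using p by (rule rep_boundary)
      have "h (SA p) = \<Theta> n (h (SA q))" using fixed[of "SA p"] p n by simp
      moreover have "SQ p = \<Theta> n (SQ q)" using Theta_S[OF n(2) p n(3,4)] by simp
      ultimately have "dQ (h (SA p)) (SQ p) \<le> dQ (h (SA q)) (SQ q) / 3"
        using Theta_contract[of n "h (SA q)" "SQ q"] n h(1) by simp
      thus "dQ (h (SA p)) (SQ p) \<le> 2 * (1/3) ^ Suc k" using Suc n by force
    qed
  qed
  hence "dQ (h (SA p)) (SQ p) \<le> 0" if "p \<in> M0" for p
    using le_0_if_le_geometric[of "1/3" _ 2] that by simp
  hence "h (SA p) = SQ p" if "p \<in> M0" for p
    using that h(1)[of "SA p"] Q.d_nonneg[of "h (SA p)" "SQ p"] Q.d_eq_0_iff[of "h (SA p)" "SQ p"]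
    by (simp add: antisym)
  thus ?thesis using h(1) fixed by (intro exI[of _ h]) simp
qed

lemma coalg_morph_exists: "\<exists>h. coalg_morph A dA SA \<alpha> Q dQ SQ \<gamma> h"
proof -
  obtain h where "(\<forall>x\<in>A. h x \<in> Q \<and> h x = \<Theta> (fst (rep x)) (h (snd (rep x)))) \<and> (\<forall>p\<in>M0. h (SA p) = SQ p)"
    using fixed_point_exists by metis
  hence h: "\<And>x. x \<in> A \<Longrightarrow> h x \<in> Q" "\<And>x. x \<in> A \<Longrightarrow> h x = \<Theta> (fst (rep x)) (h (snd (rep x)))"
    "\<And>p. p \<in> M0 \<Longrightarrow> h (SA p) = SQ p" by auto
  have "\<gamma> (h x) = ten_map Q SQ h (\<alpha> x)" if "x \<in> A" for x
  proof -
    have "\<gamma> (h x) = ten_class Q SQ (fst (rep x), h (snd (rep x)))"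
      by (subst h(2)[OF that]) (rule gamma_Theta, use rep_in h(1) that in auto)
    thus ?thesis by (simp add: ten_map_def rep_def Let_def)
  qed
  moreover have "sq_morph A dA SA Q dQ SQ h"
    unfolding sq_morph_def using h(1,3) fixed_point_short[OF h] by auto
  ultimately show ?thesis by (auto simp: coalg_morph_def)
qed

lemma coalg_morph_unique:
  assumes "coalg_morph A dA SA \<alpha> Q dQ SQ \<gamma> f" "coalg_morph A dA SA \<alpha> Q dQ SQ \<gamma> h" "x \<in> A"
  shows "f x = h x"
proof -
  have into: "f x \<in> Q" "h x \<in> Q" if "x \<in> A" for x
    using assms(1,2) that by (auto simp: coalg_morph_def sq_morph_def)
  \<comment> \<open>Every coalgebra morphism solves the fixed point equation, since
    \<open>rep\<close> is the representative used by \<open>ten_map\<close>.\<close>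
  have fixed: "\<Theta> (fst (rep x)) (u (snd (rep x))) = u x"
    if "coalg_morph A dA SA \<alpha> Q dQ SQ \<gamma> u" "x \<in> A" for u x
    by (rule Theta_gamma)
      (use that rep_in in \<open>auto simp: coalg_morph_def sq_morph_def ten_map_def rep_def Let_def\<close>)
  have "\<forall>x\<in>A. dQ (f x) (h x) \<le> 2 * (1/3) ^ k" for k
  proof (induction k)
    case 0
    thus ?case using Q.d_le_2 into by simp
  next
    case (Suc k)
    show ?case
    proof
      fix x assume x: "x \<in> A"
      have "dQ (f x) (h x) \<le> dQ (f (snd (rep x))) (h (snd (rep x))) / 3"
        by (subst fixed[OF assms(1) x, symmetric], subst fixed[OF assms(2) x, symmetric])
          (rule Theta_contract, use rep_in[OF x] into in auto)
      thus "dQ (f x) (h x) \<le> 2 * (1/3) ^ Suc k" using Suc rep_in[OF x] by force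
    qed
  qed
  hence "dQ (f x) (h x) \<le> 0" using le_0_if_le_geometric[of "1/3" _ 2] assms(3) by simp
  thus ?thesis using Q.d_nonneg[OF into[OF assms(3)]] Q.d_eq_0_iff[OF into[OF assms(3)]] by simp
qed

end

section \<open>The completion of a fixed point\<close>

locale ten_fixed_point = squams_space X d S
  for X :: "'a set" and d :: "'a \<Rightarrow> 'a \<Rightarrow> real" and S :: "real \<times> real \<Rightarrow> 'a" +
  fixes \<eta> :: "((nat \<times> nat) \<times> 'a) set \<Rightarrow> 'a" and g :: "'a \<Rightarrow> ((nat \<times> nat) \<times> 'a) set"
  assumes eta_morph: "sq_morph (ten_carrier X S) (ten_dist X d S) (ten_S X S) X d S \<eta>"
    and inverse_morph: "sq_morph X d S (ten_carrier X S) (ten_dist X d S) (ten_S X S) g"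
    and g_eta: "y \<in> ten_carrier X S \<Longrightarrow> g (\<eta> y) = y"
    and eta_g: "x \<in> X \<Longrightarrow> \<eta> (g x) = x"
begin

interpretation Q: squams_space cx cd "C_S X d S"
  by unfold_locales (rule squams_completion)

abbreviation \<gamma> where "\<gamma> \<equiv> gammaQ X d S \<eta>"

section \<open>The cell maps on the fixed point and on its completion\<close>

definition act :: "nat \<times> nat \<Rightarrow> 'a \<Rightarrow> 'a" where
  "act m x = \<eta> (cls (m, x))"

definition Theta :: "nat \<times> nat \<Rightarrow> (nat \<Rightarrow> 'a) set \<Rightarrow> (nat \<Rightarrow> 'a) set" where
  "Theta m = C_map X d (act m)"

lemma eta_in: "y \<in> ten_carrier X S \<Longrightarrow> \<eta> y \<in> X"
  using eta_morph by (auto simp: sq_morph_def)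

lemma eta_short: "y \<in> ten_carrier X S \<Longrightarrow> z \<in> ten_carrier X S \<Longrightarrow> d (\<eta> y) (\<eta> z) \<le> td y z"
  using eta_morph by (auto simp: sq_morph_def)

lemma eta_S: "p \<in> M0 \<Longrightarrow> \<eta> (ten_S X S p) = S p"
  using eta_morph by (auto simp: sq_morph_def)

lemma g_in: "x \<in> X \<Longrightarrow> g x \<in> ten_carrier X S"
  using inverse_morph by (auto simp: sq_morph_def)

lemma g_short: "x \<in> X \<Longrightarrow> y \<in> X \<Longrightarrow> td (g x) (g y) \<le> d x y"
  using inverse_morph by (auto simp: sq_morph_def)

lemma act_in: "m \<in> Mset \<Longrightarrow> x \<in> X \<Longrightarrow> act m x \<in> X"
  by (simp add: act_def eta_in ten_class_in)

lemma act_contract: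
  assumes "m \<in> Mset" "x \<in> X" "y \<in> X"
  shows "d (act m x) (act m y) \<le> d x y / 3"
  using eta_short[of "cls (m, x)" "cls (m, y)"] td_same_cell[OF assms] assms
  by (simp add: act_def ten_class_in)

lemma act_short:
  assumes "m \<in> Mset" "x \<in> X" "y \<in> X"
  shows "d (act m x) (act m y) \<le> d x y"
  using act_contract[OF assms] d_nonneg[OF assms(2,3)] by simp

lemma td_le_act:
  assumes "m \<in> Mset" "x \<in> X" "n \<in> Mset" "y \<in> X"
  shows "td (cls (m, x)) (cls (n, y)) \<le> d (act m x) (act n y)"
  using g_short[of "act m x" "act n y"] assms act_in by (simp add: act_def g_eta ten_class_in)

lemma act_cauchy: "m \<in> Mset \<Longrightarrow> \<sigma> \<in> cauchy \<Longrightarrow> act m \<circ> \<sigma> \<in> cauchy"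
  by (rule short_map_cauchy) (auto simp: act_in act_short)

lemma Theta_ccls: "m \<in> Mset \<Longrightarrow> \<sigma> \<in> cauchy \<Longrightarrow> Theta m (ccls \<sigma>) = ccls (act m \<circ> \<sigma>)"
  unfolding Theta_def by (rule C_map_eq) (auto simp: act_in act_short)

lemma Theta_in:
  assumes "m \<in> Mset" "q \<in> cx" shows "Theta m q \<in> cx"
proof -
  obtain \<sigma> where "\<sigma> \<in> cauchy" "q = ccls \<sigma>" using assms(2) by (rule cx_cases)
  thus ?thesis using assms(1) by (simp add: Theta_ccls ccls_in act_cauchy)
qed

lemma Theta_contract:
  assumes m: "m \<in> Mset" and "q \<in> cx" "q' \<in> cx"
  shows "cd (Theta m q) (Theta m q') \<le> cd q q' / 3"
proof -
  obtain \<sigma> \<tau> where s: "\<sigma> \<in> cauchy" "q = ccls \<sigma>" and t: "\<tau> \<in> cauchy" "q' = ccls \<tau>"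
    using assms(2,3) by (metis cx_cases)
  show ?thesis
    unfolding s(2) t(2) Theta_ccls[OF m s(1)] Theta_ccls[OF m t(1)]
  proof (rule LIMSEQ_le[OF cd_tendsto tendsto_divide[OF cd_tendsto tendsto_const]])
    show "\<exists>N. \<forall>n\<ge>N. d ((act m \<circ> \<sigma>) n) ((act m \<circ> \<tau>) n) \<le> d (\<sigma> n) (\<tau> n) / 3"
      using act_contract[OF m cauchy_in[OF s(1)] cauchy_in[OF t(1)]] by simp
  qed (use m s t act_cauchy in auto)
qed

lemma Theta_emb: "m \<in> Mset \<Longrightarrow> x \<in> X \<Longrightarrow> Theta m (emb x) = emb (act m x)"
  by (simp add: Theta_ccls const_cauchy comp_def)

lemma Theta_S:
  assumes "m \<in> Mset" "p \<in> M0" "r \<in> M0" "shift m r = (3 * fst p, 3 * snd p)"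
  shows "Theta m (C_S X d S r) = C_S X d S p"
  using ten_S_eq[OF assms(2,1,3,4)] eta_S[OF assms(2)] assms by (simp add: C_S_def Theta_emb act_def)

lemma Theta_glue:
  assumes "m \<in> Mset" "n \<in> Mset" "p \<in> M0" "r \<in> M0" "shift m p = shift n r"
  shows "Theta m (C_S X d S p) = Theta n (C_S X d S r)"
  using ten_glue[OF assms] assms by (simp add: C_S_def Theta_emb act_def)

text \<open>The embedding does not increase distances in the quotient, and the inverse of
  \<open>\<eta>\<close> is short, so the estimate holds for embedded approximations of
  \<open>b\<close> and \<open>b'\<close>; the two correction terms tend to 0.\<close>

lemma td_completion_le:
  assumes m: "m \<in> Mset" "b \<in> cx" and n: "n \<in> Mset" "b' \<in> cx"
  shows "Q.td (Q.cls (m, b)) (Q.cls (n, b')) \<le> cd (Theta m b) (Theta n b')"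
proof -
  obtain \<beta> \<beta>' where s: "\<beta> \<in> cauchy" "b = ccls \<beta>" and t: "\<beta>' \<in> cauchy" "b' = ccls \<beta>'"
    using m n by (metis cx_cases)
  note i = cauchy_in[OF s(1)] and i' = cauchy_in[OF t(1)]
  have le: "Q.td (Q.cls (m, b)) (Q.cls (n, b')) \<le>
     cd (emb (\<beta> k)) b / 3 + d ((act m \<circ> \<beta>) k) ((act n \<circ> \<beta>') k) + cd (emb (\<beta>' k)) b' / 3" for k
  proof -
    note e = emb_in[OF i[of k]] emb_in[OF i'[of k]]
    have "Q.td (Q.cls (m, b)) (Q.cls (n, b')) \<le>
        Q.td (Q.cls (m, b)) (Q.cls (m, emb (\<beta> k))) + Q.td (Q.cls (m, emb (\<beta> k))) (Q.cls (n, b'))"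
      by (rule Q.td_triangle) (use m n e in auto)
    moreover have "Q.td (Q.cls (m, emb (\<beta> k))) (Q.cls (n, b')) \<le>
        Q.td (Q.cls (m, emb (\<beta> k))) (Q.cls (n, emb (\<beta>' k))) + Q.td (Q.cls (n, emb (\<beta>' k))) (Q.cls (n, b'))"
      by (rule Q.td_triangle) (use m n e in auto)
    moreover have "Q.td (Q.cls (m, b)) (Q.cls (m, emb (\<beta> k))) \<le> cd (emb (\<beta> k)) b / 3"
      using Q.td_same_cell[OF m e(1)] Q.d_commute[OF m(2) e(1)] by simp
    moreover have "Q.td (Q.cls (n, emb (\<beta>' k))) (Q.cls (n, b')) \<le> cd (emb (\<beta>' k)) b' / 3"
      using Q.td_same_cell[OF n(1) e(2) n(2)] .
    moreover have "Q.td (Q.cls (m, emb (\<beta> k))) (Q.cls (n, emb (\<beta>' k))) \<le> td (cls (m, \<beta> k)) (cls (n, \<beta>' k))"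
      by (rule ten_dist_short_map[OF squams squams_completion])
        (use m n i i' in \<open>auto simp: emb_in cd_emb C_S_def\<close>)
    moreover have "\<dots> \<le> d ((act m \<circ> \<beta>) k) ((act n \<circ> \<beta>') k)"
      using td_le_act[OF m(1) i n(1) i'] by simp
    ultimately show ?thesis by linarith
  qed
  have "(\<lambda>k. cd (emb (\<beta> k)) b / 3 + d ((act m \<circ> \<beta>) k) ((act n \<circ> \<beta>') k) + cd (emb (\<beta>' k)) b' / 3)
      \<longlonglongrightarrow> 0 / 3 + cd (Theta m b) (Theta n b') + 0 / 3"
    unfolding s(2) t(2) Theta_ccls[OF m(1) s(1)] Theta_ccls[OF n(1) t(1)]
    by (intro tendsto_add tendsto_divide tendsto_const cd_tendsto emb_tendsto act_cauchy m n s t) simp_all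
  from LIMSEQ_le_const[OF this] le show ?thesis by simp
qed

text \<open>All choices hidden in \<open>\<gamma>\<close> are handled here once. Whatever they are,
  the resulting \<open>m\<close> and \<open>b\<close> satisfy \<open>Theta m b = q\<close>, which is
  all that is used later.\<close>

lemma gamma_representation:
  assumes q: "q \<in> cx"
  obtains m b where "m \<in> Mset" "b \<in> cx" "\<gamma> q = Q.cls (m, b)" "Theta m b = q"
proof -
  \<comment> \<open>These names repeat the local bindings of \<open>C_map\<close> and
    \<open>canon\<close>, so the equation for \<open>\<gamma> q\<close> holds by unfolding.\<close>
  define s where "s = (SOME \<sigma>. \<sigma> \<in> q)"
  define y where "y = inv_into (ten_carrier X S) \<eta> \<circ> s"
  define \<sigma> where "\<sigma> = (SOME \<sigma>. \<sigma> \<in> cs_rel (ten_carrier X S) td `` {y})"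
  define r where "r = (\<lambda>k. SOME r. r \<in> \<sigma> k)"
  define m where "m = (SOME m. m \<in> Mset \<and> infinite {k. fst (r k) = m})"
  define ks where "ks = enumerate {k. fst (r k) = m}"
  define b where "b = (\<lambda>j. snd (r (ks j)))"
  have gamma: "\<gamma> q = Q.cls (m, ccls b)"
    unfolding gammaQ_def C_map_def canon_def Let_def b_def ks_def m_def r_def \<sigma>_def y_def s_def ..

  obtain \<sigma>0 where s0: "\<sigma>0 \<in> cauchy" "q = ccls \<sigma>0" using q by (rule cx_cases)
  have s: "s \<in> cauchy" "ccls s = q"
    using ccls_some[OF s0(1), folded s0(2), folded s_def] ccls_eq_iff[OF s0(1), of s] s0(2) by metis+
  note s_in = cauchy_in[OF s(1)]
  have inj: "inj_on \<eta> (ten_carrier X S)" by (rule inj_on_inverseI[of _ g]) (rule g_eta)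
  have y: "y k = g (s k)" for k
    using inv_into_f_eq[OF inj g_in[OF s_in[of k]] eta_g[OF s_in[of k]]] by (simp add: y_def)
  have y_cauchy: "y \<in> cauchy_seqs (ten_carrier X S) td"
  proof -
    have "y = g \<circ> s" using y by auto
    thus ?thesis using short_map_cauchy[of g "ten_carrier X S" td s] g_in g_short s(1) by auto
  qed
  have "td c c = 0" if "c \<in> ten_carrier X S" for c
    using ten_carrier_someI[OF that] td_self[of "SOME r. r \<in> c"] by simp
  hence "y \<in> cs_rel (ten_carrier X S) td `` {y}"
    using y_cauchy g_in s_in by (auto simp: cs_rel_def y)
  hence "\<sigma> \<in> cs_rel (ten_carrier X S) td `` {y}"
    unfolding \<sigma>_def by (rule someI[of "\<lambda>\<sigma>. \<sigma> \<in> cs_rel (ten_carrier X S) td `` {y}"])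
  hence \<sigma>: "\<sigma> \<in> cauchy_seqs (ten_carrier X S) td" "(\<lambda>k. td (y k) (\<sigma> k)) \<longlonglongrightarrow> 0"
    by (auto simp: cs_rel_def)
  have \<sigma>_in: "\<sigma> k \<in> ten_carrier X S" for k using \<sigma>(1) by (auto simp: cauchy_seqs_def)
  have r: "r k \<in> Mset \<times> X" "cls (r k) = \<sigma> k" for k
    using ten_carrier_someI[OF \<sigma>_in[of k]] by (auto simp: r_def)

  \<comment> \<open>Finitely many cells, so one occurs infinitely often and the choice defining
    \<open>m\<close> is meaningful.\<close>
  have "finite ((\<lambda>k. fst (r k)) ` UNIV)"
    by (rule finite_subset[OF _ finite_Mset]) (use r(1) in \<open>force simp: mem_Times_iff\<close>)
  then obtain k0 where "infinite {k. fst (r k) = fst (r k0)}"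
    using pigeonhole_infinite[of UNIV "\<lambda>k. fst (r k)"] by auto
  hence "\<exists>m. m \<in> Mset \<and> infinite {k. fst (r k) = m}"
    using r(1)[of k0] by (intro exI[of _ "fst (r k0)"]) (simp add: mem_Times_iff)
  hence "m \<in> Mset \<and> infinite {k. fst (r k) = m}"
    unfolding m_def by (rule someI_ex)
  hence m: "m \<in> Mset" "infinite {k. fst (r k) = m}" by blast+
  have ks: "strict_mono ks" "fst (r (ks j)) = m" for j
    using strict_mono_enumerate[OF m(2)] enumerate_in_set[OF m(2), of j] by (auto simp: ks_def)
  have b: "b j \<in> X" "cls (m, b j) = \<sigma> (ks j)" for j
  proof -
    have "r (ks j) = (m, b j)" using ks(2)[of j] by (simp add: b_def prod_eq_iff)
    thus "b j \<in> X" "cls (m, b j) = \<sigma> (ks j)" using r[of "ks j"] by auto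
  qed
  have b_cauchy: "b \<in> cauchy"
    unfolding cauchy_seqs_def
  proof (intro CollectI conjI allI impI)
    show "range b \<subseteq> X" using b by auto
    fix e :: real assume e: "0 < e"
    \<comment> \<open>\<open>td_lower_detour\<close> controls inner distances only below 1, hence
      the minimum.\<close>
    hence "0 < min 1 e / 3" by simp
    hence "\<exists>N. \<forall>n n'. N \<le> n \<longrightarrow> N \<le> n' \<longrightarrow> td (\<sigma> n) (\<sigma> n') < min 1 e / 3"
      using \<sigma>(1) unfolding cauchy_seqs_def by blast
    then obtain N where N: "\<And>n n'. N \<le> n \<Longrightarrow> N \<le> n' \<Longrightarrow> td (\<sigma> n) (\<sigma> n') < min 1 e / 3" by blast
    show "\<exists>N. \<forall>n n'. N \<le> n \<longrightarrow> N \<le> n' \<longrightarrow> d (b n) (b n') < e"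
    proof (intro exI[of _ N] allI impI)
      fix n n' assume n: "N \<le> n" "N \<le> n'"
      have "td (cls (m, b n)) (cls (m, b n')) < min 1 e / 3"
        unfolding b(2) using N n seq_suble[OF ks(1)] order_trans by blast
      thus "d (b n) (b n') < e"
        using td_lower_detour[OF m(1) b(1) m(1) b(1), of n n'] by (auto simp: min_def split: if_splits)
    qed
  qed
  have lim: "(\<lambda>j. td (y (ks j)) (\<sigma> (ks j))) \<longlonglongrightarrow> 0"
    using LIMSEQ_subseq_LIMSEQ[OF \<sigma>(2) ks(1)] by (simp add: comp_def)
  \<comment> \<open>Applying the short map \<open>\<eta>\<close> to \<open>y\<close> and
    \<open>\<sigma>\<close> returns \<open>s\<close> on one side and \<open>act m\<close> of
    \<open>b\<close> on the other.\<close>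
  have le: "d ((s \<circ> ks) j) ((act m \<circ> b) j) \<le> td (y (ks j)) (\<sigma> (ks j))" for j
    using eta_short[OF g_in[OF s_in] \<sigma>_in, of "ks j" "ks j"] eta_g[OF s_in[of "ks j"]]
    by (simp add: act_def b(2) y)
  have nonneg: "0 \<le> d ((s \<circ> ks) j) ((act m \<circ> b) j)" for j
    using s_in act_in[OF m(1) b(1)] by (simp add: d_nonneg)
  have "(\<lambda>j. d ((s \<circ> ks) j) ((act m \<circ> b) j)) \<longlonglongrightarrow> 0"
    by (intro tendsto_sandwich[OF _ _ tendsto_const lim] always_eventually allI le nonneg)
  hence "ccls (s \<circ> ks) = ccls (act m \<circ> b)"
    using ccls_eq_iff[OF subseq_cauchy(1)[OF s(1) ks(1)] act_cauchy[OF m(1) b_cauchy]] by simp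
  hence "Theta m (ccls b) = q"
    using subseq_cauchy(2)[OF s(1) ks(1)] s(2) Theta_ccls[OF m(1) b_cauchy] by simp
  thus ?thesis using that[OF m(1) ccls_in[OF b_cauchy] gamma] by blast
qed

text \<open>The computed representative has the same image under \<open>Theta\<close> as
  \<open>(m, q)\<close>. By \<open>td_completion_le\<close> their classes are at distance 0, hence
  equal by separation.\<close>

lemma gamma_Theta:
  assumes "m \<in> Mset" "q \<in> cx"
  shows "\<gamma> (Theta m q) = Q.cls (m, q)"
proof -
  have T: "Theta m q \<in> cx" using Theta_in[OF assms] .
  then obtain n b where n: "n \<in> Mset" "b \<in> cx" "\<gamma> (Theta m q) = Q.cls (n, b)" "Theta n b = Theta m q"
    by (rule gamma_representation)
  have "Q.td (Q.cls (n, b)) (Q.cls (m, q)) \<le> 0"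
    using td_completion_le[OF n(1,2) assms] n(4) Q.d_self[OF T] by simp
  thus ?thesis using Q.td_eq_0_imp[OF n(1,2) assms] n(3) by simp
qed

text \<open>\<open>Theta\<close> respects the gluing, so its value does not depend on which
  representative of the class \<open>\<gamma> q\<close> is taken.\<close>

lemma Theta_gamma:
  assumes "m \<in> Mset" "q \<in> cx" "q' \<in> cx" "\<gamma> q = Q.cls (m, q')"
  shows "Theta m q' = q"
proof -
  obtain n b where n: "n \<in> Mset" "b \<in> cx" "\<gamma> q = Q.cls (n, b)" "Theta n b = q"
    using assms(2) by (rule gamma_representation)
  have rel: "((m, q'), (n, b)) \<in> ten_rel cx (C_S X d S)"
    using n assms by (subst ten_class_eq_iff[symmetric]) auto
  have "compatible (C_S X d S) (\<lambda>z. Theta (fst z) (snd z))"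
    unfolding compatible_def fst_conv snd_conv using Theta_glue by blast
  from ten_rel_compatible[OF rel this] show ?thesis using n(4) by simp
qed

lemma gamma_coalgebra: "is_coalg cx cd (C_S X d S) \<gamma>"
  unfolding is_coalg_def sq_morph_def
proof (intro conjI ballI)
  show "squams cx cd (C_S X d S)" by (rule squams_completion)
  show "\<gamma> ` cx \<subseteq> ten_carrier cx (C_S X d S)"
  proof (rule image_subsetI)
    fix q assume "q \<in> cx"
    then obtain m b where "m \<in> Mset" "b \<in> cx" "\<gamma> q = Q.cls (m, b)" by (rule gamma_representation)
    thus "\<gamma> q \<in> ten_carrier cx (C_S X d S)" by (simp add: ten_class_in)
  qed
next
  fix q q' assume q: "q \<in> cx" "q' \<in> cx"
  obtain m b where m: "m \<in> Mset" "b \<in> cx" "\<gamma> q = Q.cls (m, b)" "Theta m b = q"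
    using q(1) by (rule gamma_representation)
  obtain n b' where n: "n \<in> Mset" "b' \<in> cx" "\<gamma> q' = Q.cls (n, b')" "Theta n b' = q'"
    using q(2) by (rule gamma_representation)
  show "Q.td (\<gamma> q) (\<gamma> q') \<le> cd q q'"
    using td_completion_le[OF m(1,2) n(1,2)] m n by simp
next
  fix p assume p: "p \<in> M0"
  obtain m r where m: "m \<in> Mset" "r \<in> M0" "shift m r = (3 * fst p, 3 * snd p)"
    using p by (rule M0_cell)
  have "\<gamma> (Theta m (C_S X d S r)) = Q.cls (m, C_S X d S r)"
    using m by (intro gamma_Theta) auto
  thus "\<gamma> (C_S X d S p) = ten_S cx (C_S X d S) p"
    using Theta_S[OF m(1) p m(2,3)] Q.ten_S_eq[OF p m] by simp
qed

lemma self_similar_completion: "self_similar cx cd (C_S X d S) \<gamma> Theta"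
proof
  fix s assume "s \<in> cauchy_seqs cx cd"
  then obtain q where "q \<in> cx" "(\<lambda>k. cd (s k) q) \<longlonglongrightarrow> 0" by (rule completion_complete)
  thus "\<exists>q\<in>cx. (\<lambda>k. cd (s k) q) \<longlonglongrightarrow> 0" by blast
qed (rule Theta_in Theta_contract Theta_S Theta_glue gamma_Theta Theta_gamma; assumption)+

end

theorem mainTheorem2:
  fixes G :: "'g set" and d :: "'g \<Rightarrow> 'g \<Rightarrow> real" and S :: "real \<times> real \<Rightarrow> 'g"
    and \<eta> :: "((nat \<times> nat) \<times> 'g) set \<Rightarrow> 'g"
  assumes alg: "is_alg G d S \<eta>"
    and iso: "\<exists>g. sq_morph G d S (ten_carrier G S) (ten_dist G d S) (ten_S G S) g \<and>
                 (\<forall>y\<in>ten_carrier G S. g (\<eta> y) = y) \<and> (\<forall>x\<in>G. \<eta> (g x) = x)"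
    and initial: "\<And>(B :: 'g set) dB SB b. is_alg B dB SB b \<Longrightarrow>
        (\<exists>h. alg_morph G d S \<eta> B dB SB b h) \<and>
        (\<forall>h1 h2. alg_morph G d S \<eta> B dB SB b h1 \<longrightarrow> alg_morph G d S \<eta> B dB SB b h2 \<longrightarrow>
                 (\<forall>x\<in>G. h1 x = h2 x))"
  shows "is_coalg (C_carrier G d) (C_dist d) (C_S G d S) (gammaQ G d S \<eta>) \<and>
    (\<forall>(A :: 'c set) dA SA \<alpha>. is_coalg A dA SA \<alpha> \<longrightarrow>
      (\<exists>h. coalg_morph A dA SA \<alpha> (C_carrier G d) (C_dist d) (C_S G d S) (gammaQ G d S \<eta>) h) \<and>
      (\<forall>h1 h2. coalg_morph A dA SA \<alpha> (C_carrier G d) (C_dist d) (C_S G d S) (gammaQ G d S \<eta>) h1 \<longrightarrow>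
               coalg_morph A dA SA \<alpha> (C_carrier G d) (C_dist d) (C_S G d S) (gammaQ G d S \<eta>) h2 \<longrightarrow>
               (\<forall>x\<in>A. h1 x = h2 x)))"
proof -
  obtain g where g: "sq_morph G d S (ten_carrier G S) (ten_dist G d S) (ten_S G S) g"
    "\<forall>y\<in>ten_carrier G S. g (\<eta> y) = y" "\<forall>x\<in>G. \<eta> (g x) = x" using iso by blast
  interpret G: ten_fixed_point G d S \<eta> g
    by unfold_locales (use alg g in \<open>auto simp: is_alg_def\<close>)
  show ?thesis
  proof (rule conjI[OF G.gamma_coalgebra], intro allI impI)
    fix A :: "'c set" and dA SA \<alpha> assume "is_coalg A dA SA \<alpha>"
    hence A: "squams A dA SA" "sq_morph A dA SA (ten_carrier A SA) (ten_dist A dA SA) (ten_S A SA) \<alpha>"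
      by (auto simp: is_coalg_def)
    interpret Q: self_similar "C_carrier G d" "C_dist d" "C_S G d S" "gammaQ G d S \<eta>" G.Theta
      by (rule G.self_similar_completion)
    interpret coalgebra_into "C_carrier G d" "C_dist d" "C_S G d S" "gammaQ G d S \<eta>" G.Theta A dA SA \<alpha>
      by unfold_locales (use A in auto)
    show "(\<exists>h. coalg_morph A dA SA \<alpha> (C_carrier G d) (C_dist d) (C_S G d S) (gammaQ G d S \<eta>) h) \<and>
      (\<forall>h1 h2. coalg_morph A dA SA \<alpha> (C_carrier G d) (C_dist d) (C_S G d S) (gammaQ G d S \<eta>) h1 \<longrightarrow>
               coalg_morph A dA SA \<alpha> (C_carrier G d) (C_dist d) (C_S G d S) (gammaQ G d S \<eta>) h2 \<longrightarrow>
               (\<forall>x\<in>A. h1 x = h2 x))"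
      using coalg_morph_exists coalg_morph_unique by blast
  qed
qed

end
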